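(* Consider the two-component system for $u=u(x,t)$, $v=v(x,t)$ $$m_t=(mH)_x+mH-\tfrac12 m(u-u_x)(v+v_x),\qquad n_t=(nH)_x-nH+\tfrac12 n(u-u_x)(v+v_x),$$ with $m=u-u_{xx}$, $n=v-v_{xx}$, specified as an autonomous system of partial differential equations by making a particular choice of function $H=h(u,v,u_x,v_x,\ldots)$ of $u,v$ and their $x$-derivatives. Then there is a reciprocal transformation (a change of independent variables $(x,t)\to(X,T)$, with accompanying new fields, as specified in the context) to a triangular system for $\vartheta=\vartheta(X,T)$ and $\kappa=\kappa(X,T)$, given by $$\vartheta_T+\frac14\left(\frac{(\vartheta_{XT}-2)^2}{4\vartheta^2}-\vartheta_T^2\right)_X=0,\qquad \kappa_T+\kappa\,\mathcal F[\vartheta,\kappa]=0,$$ where $\mathcal F[\vartheta,\kappa]$ denotes a (possibly nonlocal) function of $\vartheta$, $\kappa$ and their $X$-derivatives.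
   Context: Subscripts denote partial derivatives. A reciprocal transformation is a change of independent variables built from a conservation law of the system: if $q_t=(qH)_x$ holds on solutions, new independent variables are defined by $\mathrm dX=q\,\mathrm dx+qH\,\mathrm dt$, $\mathrm dT=\mathrm dt$, so that $D_x=q\,D_X$ and $D_t=D_T+qH\,D_X$. The fields are defined as follows. First rescale the dependent variables by $u\to 2u$, $v\to-2v$ (hence $m\to2m$, $n\to-2n$), leaving $H$ as the same function of $x,t$. In the rescaled variables put $A=u-u_x$, $B=v+v_x$, so that $m=A+A_x$, $n=B-B_x$, and the system reads $$m_t=(mH)_x+mH+2mAB,\qquad n_t=(nH)_x-nH-2nAB.$$ With $m,n$ denoting the rescaled quantities, set $$q=\sqrt{mn},\qquad \kappa=\sqrt{n/m},\qquad \vartheta=-\frac{1}{2q}+\frac12(\log\kappa)_X .$$ "Triangular" means that the first equation involves $\vartheta$ alone. "Possibly nonlocal" means that $\mathcal F[\vartheta,\kappa]$ may involve $\vartheta_T$, $\vartheta_{XT}$, or quantities obtained by inverting differential operators in $X$ (for instance recovering $u,v$ from $A=u-q\,u_X$ and $B=v+q\,v_X$), in addition to $\vartheta,\kappa$ and their $X$-derivatives. All functions are assumed sufficiently smooth, and considered locally where the expressions written are defined (e.g. $q\neq0$, $\vartheta\ne 0$). *)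

theory Defs
  imports "HOL-Analysis.Analysis"
begin

primrec Ck_on :: "nat \<Rightarrow> 'a::real_normed_vector set \<Rightarrow> ('a \<Rightarrow> 'b::real_normed_vector) \<Rightarrow> bool" where
  "Ck_on 0 S f \<longleftrightarrow> continuous_on S f"
| "Ck_on (Suc k) S f \<longleftrightarrow> (\<forall>p\<in>S. f differentiable (at p)) \<and>
     (\<forall>d. Ck_on k S (\<lambda>p. frechet_derivative f (at p) d))"

definition smooth_on :: "'a::real_normed_vector set \<Rightarrow> ('a \<Rightarrow> 'b::real_normed_vector) \<Rightarrow> bool" where
  "smooth_on S f \<longleftrightarrow> (\<forall>k. Ck_on k S f)"

type_synonym field2 = "real \<times> real \<Rightarrow> real"

text \<open>The same two operators serve for the independent variables \<open>(x, t)\<close> and \<open>(X, T)\<close>.\<close>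

definition D1 :: "field2 \<Rightarrow> field2" where
  "D1 f p = deriv (\<lambda>s. f (s, snd p)) (fst p)"

definition D2 :: "field2 \<Rightarrow> field2" where
  "D2 f p = deriv (\<lambda>s. f (fst p, s)) (snd p)"

text \<open>A function \<open>h\<close> of finitely many of \<open>u, v, u\<^sub>x, v\<^sub>x, \<dots>\<close> is a function on \<open>real ^ 'k\<close>
  together with a map \<open>J\<close> saying which jet variable is fed into which coordinate;
  \<open>Ujet j\<close> stands for the \<open>j\<close>-th \<open>x\<close>-derivative of \<open>u\<close>, and \<open>Vjet j\<close> for that of \<open>v\<close>.\<close>

datatype jetvar = Ujet nat | Vjet nat

primrec jet_val :: "field2 \<Rightarrow> field2 \<Rightarrow> jetvar \<Rightarrow> field2" where
  "jet_val u v (Ujet j) = (D1 ^^ j) u"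
| "jet_val u v (Vjet j) = (D1 ^^ j) v"

definition jet_point :: "('k \<Rightarrow> jetvar) \<Rightarrow> field2 \<Rightarrow> field2 \<Rightarrow> real \<times> real \<Rightarrow> real ^ 'k" where
  "jet_point J u v p = (\<chi> i. jet_val u v (J i) p)"

definition Hfield :: "(real ^ 'k \<Rightarrow> real) \<Rightarrow> ('k \<Rightarrow> jetvar) \<Rightarrow> field2 \<Rightarrow> field2 \<Rightarrow> field2" where
  "Hfield h J u v p = h (jet_point J u v p)"

definition momentum :: "field2 \<Rightarrow> field2" where
  "momentum w p = w p - D1 (D1 w) p"

text \<open>\<open>\<Omega>\<close> is the domain of \<open>h\<close> in jet space, \<open>U\<close> the domain of the solution.\<close>

definition is_solution ::
  "(real ^ 'k \<Rightarrow> real) \<Rightarrow> (real ^ 'k) set \<Rightarrow> ('k \<Rightarrow> jetvar) \<Rightarrow> (real \<times> real) set \<Rightarrow> field2 \<Rightarrow> field2 \<Rightarrow> bool" where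
  "is_solution h \<Omega> J U u v \<longleftrightarrow>
     open U \<and> smooth_on U u \<and> smooth_on U v \<and> (\<forall>p\<in>U. jet_point J u v p \<in> \<Omega>) \<and>
     (let m = momentum u; n = momentum v; H = Hfield h J u v in
       \<forall>p\<in>U.
         D2 m p = D1 (\<lambda>r. m r * H r) p + m p * H p
                  - 1/2 * m p * (u p - D1 u p) * (v p + D1 v p) \<and>
         D2 n p = D1 (\<lambda>r. n r * H r) p - n p * H p
                  + 1/2 * n p * (u p - D1 u p) * (v p + D1 v p))"

text \<open>The substitution \<open>u \<rightarrow> 2u\<close>, \<open>v \<rightarrow> -2v\<close>: the rescaled fields are \<open>u/2\<close> and \<open>-v/2\<close>.\<close>

definition m_resc :: "field2 \<Rightarrow> field2" where
  "m_resc u = momentum (\<lambda>p. u p / 2)"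

definition n_resc :: "field2 \<Rightarrow> field2" where
  "n_resc v = momentum (\<lambda>p. - v p / 2)"

definition q_field :: "field2 \<Rightarrow> field2 \<Rightarrow> field2" where
  "q_field u v p = sqrt (m_resc u p * n_resc v p)"

definition kappa_field :: "field2 \<Rightarrow> field2 \<Rightarrow> field2" where
  "kappa_field u v p = sqrt (n_resc v p / m_resc u p)"

definition recip_map :: "field2 \<Rightarrow> real \<times> real \<Rightarrow> real \<times> real" where
  "recip_map X p = (X p, snd p)"

text \<open>The second and the last line say that \<open>q\<^sub>t = (qH)\<^sub>x\<close> is a conservation law and that
  \<open>dX = q dx + qH dt\<close>; with \<open>T = t\<close>, the map \<open>(x, t) \<mapsto> (X, T)\<close> is a diffeomorphism
  of \<open>W\<close> onto an open set.\<close>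

definition reciprocal_transformation ::
  "field2 \<Rightarrow> field2 \<Rightarrow> (real \<times> real) set \<Rightarrow> field2 \<Rightarrow> bool" where
  "reciprocal_transformation q H W X \<longleftrightarrow>
     open W \<and>
     (\<forall>p\<in>W. q p \<noteq> 0 \<and> D2 q p = D1 (\<lambda>r. q r * H r) p) \<and>
     smooth_on W X \<and> inj_on (recip_map X) W \<and> open (recip_map X ` W) \<and>
     smooth_on (recip_map X ` W) (inv_into W (recip_map X)) \<and>
     (\<forall>p\<in>W. (X has_derivative (\<lambda>d. q p * fst d + q p * H p * snd d)) (at p))"

definition pushforward :: "(real \<times> real) set \<Rightarrow> field2 \<Rightarrow> field2 \<Rightarrow> field2" where
  "pushforward W X f P = f (inv_into W (recip_map X) P)"

definition theta_field :: "field2 \<Rightarrow> field2 \<Rightarrow> field2" where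
  "theta_field q \<kappa> P = - 1 / (2 * q P) + 1/2 * D1 (\<lambda>R. ln (\<kappa> R)) P"

text \<open>Expressions in \<open>\<vartheta>\<close>, \<open>\<kappa>\<close>, \<open>\<vartheta>\<^sub>T\<close>, nonlocal variables \<open>w\<^sub>0, w\<^sub>1, \<dots>\<close> and the
  \<open>X\<close>-derivatives of these, combined pointwise by the field operations and by smooth functions
  \<open>g\<close> on open sets \<open>D\<close>. The only \<open>T\<close>-derivative available is \<open>\<vartheta>\<^sub>T\<close>, together with its
  \<open>X\<close>-derivatives; in particular \<open>\<kappa>\<^sub>T\<close> is not an expression.\<close>

datatype (dead 'k::finite) dexpr =
    Theta | Kappa | ThetaT | Nonloc nat | Const real
  | Add "'k dexpr" "'k dexpr" | Mul "'k dexpr" "'k dexpr" | Div "'k dexpr" "'k dexpr"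
  | DX "'k dexpr"
  | Fn "real ^ 'k \<Rightarrow> real" "(real ^ 'k) set" "'k \<Rightarrow> 'k dexpr"

text \<open>Here \<open>r\<close> bounds the indices of the nonlocal variables.\<close>

primrec wf_dexpr :: "nat \<Rightarrow> ('k::finite) dexpr \<Rightarrow> bool" where
  "wf_dexpr r Theta \<longleftrightarrow> True"
| "wf_dexpr r Kappa \<longleftrightarrow> True"
| "wf_dexpr r ThetaT \<longleftrightarrow> True"
| "wf_dexpr r (Nonloc i) \<longleftrightarrow> i < r"
| "wf_dexpr r (Const c) \<longleftrightarrow> True"
| "wf_dexpr r (Add a b) \<longleftrightarrow> wf_dexpr r a \<and> wf_dexpr r b"
| "wf_dexpr r (Mul a b) \<longleftrightarrow> wf_dexpr r a \<and> wf_dexpr r b"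
| "wf_dexpr r (Div a b) \<longleftrightarrow> wf_dexpr r a \<and> wf_dexpr r b"
| "wf_dexpr r (DX a) \<longleftrightarrow> wf_dexpr r a"
| "wf_dexpr r (Fn g D es) \<longleftrightarrow> open D \<and> smooth_on D g \<and> (\<forall>i. wf_dexpr r (es i))"

primrec deval :: "field2 \<Rightarrow> field2 \<Rightarrow> (nat \<Rightarrow> field2) \<Rightarrow> ('k::finite) dexpr \<Rightarrow> field2" where
  "deval \<theta> \<kappa> w Theta = \<theta>"
| "deval \<theta> \<kappa> w Kappa = \<kappa>"
| "deval \<theta> \<kappa> w ThetaT = D2 \<theta>"
| "deval \<theta> \<kappa> w (Nonloc i) = w i"
| "deval \<theta> \<kappa> w (Const c) = (\<lambda>P. c)"
| "deval \<theta> \<kappa> w (Add a b) = (\<lambda>P. deval \<theta> \<kappa> w a P + deval \<theta> \<kappa> w b P)"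
| "deval \<theta> \<kappa> w (Mul a b) = (\<lambda>P. deval \<theta> \<kappa> w a P * deval \<theta> \<kappa> w b P)"
| "deval \<theta> \<kappa> w (Div a b) = (\<lambda>P. deval \<theta> \<kappa> w a P / deval \<theta> \<kappa> w b P)"
| "deval \<theta> \<kappa> w (DX a) = D1 (deval \<theta> \<kappa> w a)"
| "deval \<theta> \<kappa> w (Fn g D es) = (\<lambda>P. g (\<chi> i. deval \<theta> \<kappa> w (es i) P))"

primrec defined_on ::
  "(real \<times> real) set \<Rightarrow> field2 \<Rightarrow> field2 \<Rightarrow> (nat \<Rightarrow> field2) \<Rightarrow> ('k::finite) dexpr \<Rightarrow> bool" where
  "defined_on V \<theta> \<kappa> w Theta \<longleftrightarrow> True"
| "defined_on V \<theta> \<kappa> w Kappa \<longleftrightarrow> True"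
| "defined_on V \<theta> \<kappa> w ThetaT \<longleftrightarrow> True"
| "defined_on V \<theta> \<kappa> w (Nonloc i) \<longleftrightarrow> True"
| "defined_on V \<theta> \<kappa> w (Const c) \<longleftrightarrow> True"
| "defined_on V \<theta> \<kappa> w (Add a b) \<longleftrightarrow> defined_on V \<theta> \<kappa> w a \<and> defined_on V \<theta> \<kappa> w b"
| "defined_on V \<theta> \<kappa> w (Mul a b) \<longleftrightarrow> defined_on V \<theta> \<kappa> w a \<and> defined_on V \<theta> \<kappa> w b"
| "defined_on V \<theta> \<kappa> w (Div a b) \<longleftrightarrow> defined_on V \<theta> \<kappa> w a \<and> defined_on V \<theta> \<kappa> w b \<and>
     (\<forall>P\<in>V. deval \<theta> \<kappa> w b P \<noteq> 0)"
| "defined_on V \<theta> \<kappa> w (DX a) \<longleftrightarrow> defined_on V \<theta> \<kappa> w a"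
| "defined_on V \<theta> \<kappa> w (Fn g D es) \<longleftrightarrow> (\<forall>i. defined_on V \<theta> \<kappa> w (es i)) \<and>
     (\<forall>P\<in>V. (\<chi> i. deval \<theta> \<kappa> w (es i) P) \<in> D)"

text \<open>A possibly nonlocal function is an expression \<open>e\<close> together with linear ordinary
  differential equations in \<open>X\<close> that introduce its nonlocal variables: the entry
  \<open>([a\<^sub>0, \<dots>, a\<^sub>d], f)\<close> at position \<open>i\<close> stands for
  \<open>a\<^sub>0 w\<^sub>i + a\<^sub>1 \<partial>\<^sub>X w\<^sub>i + \<dots> + a\<^sub>d \<partial>\<^sub>X\<^sup>d w\<^sub>i = f\<close>, where \<open>a\<^sub>0, \<dots>, a\<^sub>d, f\<close> may involve the
  earlier nonlocal variables.\<close>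

type_synonym 'k nonlocal_fun = "('k dexpr list \<times> 'k dexpr) list \<times> 'k dexpr"

definition wf_nonlocal :: "('k::finite) nonlocal_fun \<Rightarrow> bool" where
  "wf_nonlocal F \<longleftrightarrow>
     (case F of (eqs, e) \<Rightarrow>
       (\<forall>i<length eqs. case eqs ! i of (as, f) \<Rightarrow>
          as \<noteq> [] \<and> (\<forall>a\<in>set as. wf_dexpr i a) \<and> wf_dexpr i f) \<and>
       wf_dexpr (length eqs) e)"

text \<open>Inverting a differential operator in \<open>X\<close> (with nonvanishing leading coefficient)
  determines the result up to integration constants, which are functions of \<open>T\<close>; hence the
  set of all values on \<open>V\<close> rather than a single one.\<close>

definition nonlocal_values ::
  "('k::finite) nonlocal_fun \<Rightarrow> (real \<times> real) set \<Rightarrow> field2 \<Rightarrow> field2 \<Rightarrow> field2 set" where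
  "nonlocal_values F V \<theta> \<kappa> =
     (case F of (eqs, e) \<Rightarrow>
       {deval \<theta> \<kappa> w e | w.
          defined_on V \<theta> \<kappa> w e \<and>
          (\<forall>i<length eqs. smooth_on V (w i) \<and>
             (case eqs ! i of (as, f) \<Rightarrow>
               (\<forall>a\<in>set as. defined_on V \<theta> \<kappa> w a) \<and> defined_on V \<theta> \<kappa> w f \<and>
               (\<forall>P\<in>V. deval \<theta> \<kappa> w (last as) P \<noteq> 0 \<and>
                  (\<Sum>j<length as. deval \<theta> \<kappa> w (as ! j) P * (D1 ^^ j) (w i) P)
                    = deval \<theta> \<kappa> w f P)))})"

definition triangular_system ::
  "('k::finite) nonlocal_fun \<Rightarrow> (real \<times> real) set \<Rightarrow> field2 \<Rightarrow> field2 \<Rightarrow> bool" where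
  "triangular_system F V \<theta> \<kappa> \<longleftrightarrow>
     smooth_on V \<theta> \<and> smooth_on V \<kappa> \<and>
     (\<forall>P\<in>V. D2 \<theta> P +
        1/4 * D1 (\<lambda>R. (D2 (D1 \<theta>) R - 2)\<^sup>2 / (4 * (\<theta> R)\<^sup>2) - (D2 \<theta> R)\<^sup>2) P = 0) \<and>
     (\<exists>f\<in>nonlocal_values F V \<theta> \<kappa>. \<forall>P\<in>V. D2 \<kappa> P + \<kappa> P * f P = 0)"

end

theory Submission imports Defs
begin

text \<open>Write \<open>m = \<sigma> q / \<kappa>\<close> and \<open>n = \<sigma> q \<kappa>\<close> with a locally constant sign \<open>\<sigma>\<close>. In the variables
  \<open>(X, T)\<close> the definitions of \<open>m, n\<close> become \<open>A\<^sub>X = \<sigma>/\<kappa> - A/q\<close> and \<open>B\<^sub>X = B/q - \<sigma>\<kappa>\<close>, and the evolution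
  equations become \<open>(1/q)\<^sub>T = - H\<^sub>X\<close> and \<open>(log \<kappa>)\<^sub>T = - H - 2AB\<close>. For \<open>a = \<sigma>\<kappa>A\<close>, \<open>b = \<sigma>B/\<kappa>\<close>
  this gives \<open>\<vartheta>\<^sub>T = - (ab)\<^sub>X = a - b\<close>, \<open>a\<^sub>X = 1 + 2\<vartheta>a\<close> and \<open>b\<^sub>X = - 1 - 2\<vartheta>b\<close>, hence
  \<open>\<vartheta>\<^sub>X\<^sub>T = 2 + 2\<vartheta>(a + b)\<close>. So \<open>a, b\<close> are functions of \<open>\<vartheta>, \<vartheta>\<^sub>T, \<vartheta>\<^sub>X\<^sub>T\<close>, and the equation for
  \<open>\<vartheta>\<close> is \<open>\<vartheta>\<^sub>T + (ab)\<^sub>X = 0\<close> with \<open>4ab = (a + b)\<^sup>2 - (a - b)\<^sup>2\<close>. In \<open>\<F> = H + 2ab\<close> the jet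
  variables of \<open>H\<close> are recovered from \<open>q = 1/((log \<kappa>)\<^sub>X - 2\<vartheta>)\<close> and the linear equations
  \<open>u - q u\<^sub>X = A\<close>, \<open>v + q v\<^sub>X = B\<close>.\<close>

section \<open>Calculus of smooth functions\<close>

lemma frechet_derivative_eq: "(f has_derivative f') (at p) \<Longrightarrow> frechet_derivative f (at p) = f'"
  using frechet_derivative_at by metis

text \<open>Derivatives in \<open>Ck_on\<close> are taken in full neighbourhoods; since
  \<open>S\<close> is open, agreement on \<open>S\<close> alone forces equal derivatives at every
  point of \<open>S\<close>, and the induction passes to these.\<close>

lemma Ck_on_cong:
  assumes "open S" "\<And>p. p \<in> S \<Longrightarrow> f p = g p" "Ck_on k S f"
  shows "Ck_on k S g"
  using assms(2,3)
proof (induction k arbitrary: f g)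
  case 0
  then show ?case by (auto cong: continuous_on_cong)
next
  case (Suc k)
  have der: "(g has_derivative frechet_derivative f (at p)) (at p)" if "p \<in> S" for p
  proof (rule has_derivative_transform_within_open[OF _ assms(1) that])
    show "(f has_derivative frechet_derivative f (at p)) (at p)"
      using Suc.prems(2) that frechet_derivative_works by auto
  qed (rule Suc.prems(1))
  have "Ck_on k S (\<lambda>p. frechet_derivative g (at p) d)" for d
  proof (rule Suc.IH)
    show "Ck_on k S (\<lambda>p. frechet_derivative f (at p) d)"
      using Suc.prems(2) by simp
  qed (simp add: frechet_derivative_eq[OF der])
  then show ?case using differentiableI[OF der] by simp
qed

text \<open>\<open>frechet_derivative\<close> is a choice, but derivatives are unique, so any
  explicit formula \<open>f'\<close> may stand in for it. The closure proofs below exhibit the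
  derivative and show that it is one class lower.\<close>

lemma Ck_on_SucI:
  assumes "open S" "\<And>p. p \<in> S \<Longrightarrow> (f has_derivative f' p) (at p)"
    and "\<And>d. Ck_on k S (\<lambda>p. f' p d)"
  shows "Ck_on (Suc k) S f"
proof -
  have "Ck_on k S (\<lambda>p. frechet_derivative f (at p) d)" for d
    by (rule Ck_on_cong[OF assms(1) _ assms(3)]) (simp add: frechet_derivative_eq[OF assms(2)])
  then show ?thesis using differentiableI[OF assms(2)] by simp
qed

lemma Ck_on_SucD: "Ck_on (Suc k) S f \<Longrightarrow> Ck_on k S f"
proof (induction k arbitrary: f)
  case 0
  then show ?case
    by (auto intro!: differentiable_imp_continuous_on differentiable_at_imp_differentiable_on)
next
  case (Suc k)
  then show ?case by simp
qed

lemma Ck_on_Suc_has_derivative: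
  "Ck_on (Suc k) S f \<Longrightarrow> p \<in> S \<Longrightarrow> (f has_derivative frechet_derivative f (at p)) (at p)"
  by (simp add: frechet_derivative_works[symmetric])

lemma Ck_on_const: "open S \<Longrightarrow> Ck_on k S (\<lambda>p. c)"
proof (induction k arbitrary: c)
  case (Suc k)
  then show ?case by (intro Ck_on_SucI[where f' = "\<lambda>p d. 0"]) auto
qed auto

lemma Ck_on_bounded_linear:
  assumes "open S" "bounded_linear L" "Ck_on k S f"
  shows "Ck_on k S (\<lambda>p. L (f p))"
  using assms(3)
proof (induction k arbitrary: f)
  case 0
  then show ?case using bounded_linear.continuous_on[OF assms(2)] by simp
next
  case (Suc k)
  show ?case
    by (rule Ck_on_SucI[OF assms(1) bounded_linear.has_derivative[OF assms(2)
          Ck_on_Suc_has_derivative[OF Suc.prems]]])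
      (assumption, rule Suc.IH, use Suc.prems in simp)
qed

lemma Ck_on_add:
  assumes "open S" "Ck_on k S f" "Ck_on k S g"
  shows "Ck_on k S (\<lambda>p. f p + g p)"
  using assms(2,3)
proof (induction k arbitrary: f g)
  case 0
  then show ?case by (simp add: continuous_on_add)
next
  case (Suc k)
  show ?case
    by (rule Ck_on_SucI[OF assms(1) has_derivative_add[OF
          Ck_on_Suc_has_derivative[OF Suc.prems(1)] Ck_on_Suc_has_derivative[OF Suc.prems(2)]]])
      (assumption, assumption, rule Suc.IH, use Suc.prems in simp_all)
qed

lemma Ck_on_bilinear:
  assumes "open S" "bounded_bilinear B" "Ck_on k S f" "Ck_on k S g"
  shows "Ck_on k S (\<lambda>p. B (f p) (g p))"
  using assms(3,4)
proof (induction k arbitrary: f g)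
  case 0
  then show ?case using bounded_bilinear.continuous_on[OF assms(2)] by simp
next
  case (Suc k)
  show ?case
    by (rule Ck_on_SucI[OF assms(1) bounded_bilinear.FDERIV[OF assms(2)
          Ck_on_Suc_has_derivative[OF Suc.prems(1)] Ck_on_Suc_has_derivative[OF Suc.prems(2)]]])
      (assumption, assumption, intro Ck_on_add assms(1) Suc.IH Ck_on_SucD[OF Suc.prems(1)] Ck_on_SucD[OF Suc.prems(2)],
        use Suc.prems in simp_all)
qed

lemma Ck_on_sum:
  assumes "open S" "\<And>i. i \<in> I \<Longrightarrow> Ck_on k S (f i)"
  shows "Ck_on k S (\<lambda>p. \<Sum>i\<in>I. f i p)"
  using assms(2)
  by (induction I rule: infinite_finite_induct) (auto intro!: Ck_on_add Ck_on_const assms(1))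

text \<open>\<open>Ck_on\<close> controls a derivative only in a fixed direction, whereas the chain
  rule applies the derivative of \<open>g\<close> to the moving vector \<open>?f' p d\<close>.
  Expanding that vector in \<open>Basis\<close> leaves a sum of products of coordinates with
  derivatives in fixed directions, to which the induction hypothesis applies.\<close>

lemma Ck_on_compose:
  fixes f :: "'a::real_normed_vector \<Rightarrow> 'b::euclidean_space"
    and g :: "'b \<Rightarrow> 'c::real_normed_vector"
  assumes "open S" "open T" "f ` S \<subseteq> T" "Ck_on k S f" "Ck_on k T g"
  shows "Ck_on k S (\<lambda>p. g (f p))"
  using assms(4,5)
proof (induction k arbitrary: g)
  case 0
  then show ?case using continuous_on_compose2[OF _ _ assms(3)] by simp
next
  case (Suc k)
  let ?g' = "\<lambda>y. frechet_derivative g (at y)" and ?f' = "\<lambda>p. frechet_derivative f (at p)"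
  show ?case
  proof (rule Ck_on_SucI[OF assms(1)])
    show "((\<lambda>p. g (f p)) has_derivative (\<lambda>d. \<Sum>b\<in>Basis. (?f' p d \<bullet> b) *\<^sub>R ?g' (f p) b)) (at p)"
      if "p \<in> S" for p
    proof -
      have g: "(g has_derivative ?g' (f p)) (at (f p))"
        using Ck_on_Suc_has_derivative[OF Suc.prems(2)] assms(3) that by blast
      have *: "?g' (f p) y = (\<Sum>b\<in>Basis. (y \<bullet> b) *\<^sub>R ?g' (f p) b)" for y
      proof -
        interpret bounded_linear "?g' (f p)"
          using g by (rule has_derivative_bounded_linear)
        have "?g' (f p) y = ?g' (f p) (\<Sum>b\<in>Basis. (y \<bullet> b) *\<^sub>R b)"
          by (simp only: euclidean_representation)
        then show ?thesis by (simp only: sum scaleR)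
      qed
      show ?thesis
        by (rule has_derivative_eq_rhs[OF has_derivative_compose[OF
                Ck_on_Suc_has_derivative[OF Suc.prems(1) that] g]]) (rule ext, rule *)
    qed
    show "Ck_on k S (\<lambda>p. \<Sum>b\<in>Basis. (?f' p d \<bullet> b) *\<^sub>R ?g' (f p) b)" for d
    proof (intro Ck_on_sum Ck_on_bilinear[OF _ bounded_bilinear_scaleR] assms(1))
      fix b :: 'b
      show "Ck_on k S (\<lambda>p. ?f' p d \<bullet> b)"
        using Suc.prems(1)
        by (intro Ck_on_bounded_linear[OF assms(1) bounded_linear_inner_left]) auto
      show "Ck_on k S (\<lambda>p. ?g' (f p) b)"
        using Suc.prems by (intro Suc.IH[of "\<lambda>y. ?g' y b"] Ck_on_SucD[OF Suc.prems(1)]) auto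
    qed
  qed
qed

lemma Ck_on_mult:
  fixes f g :: "'a::real_normed_vector \<Rightarrow> real"
  shows "open S \<Longrightarrow> Ck_on k S f \<Longrightarrow> Ck_on k S g \<Longrightarrow> Ck_on k S (\<lambda>p. f p * g p)"
  using Ck_on_bilinear[OF _ bounded_bilinear_mult] .

text \<open>The derivative of 1/f is a product of f' and two copies of 1/f, so the statement for the
  same f one class lower is enough; the square root below is treated in the same way.\<close>

lemma Ck_on_inverse:
  fixes f :: "'a::real_normed_vector \<Rightarrow> real"
  assumes "open S" "Ck_on k S f" "\<And>p. p \<in> S \<Longrightarrow> f p \<noteq> 0"
  shows "Ck_on k S (\<lambda>p. inverse (f p))"
  using assms(2)
proof (induction k)
  case 0
  then show ?case using assms(3) by (simp add: continuous_on_inverse)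
next
  case (Suc k)
  show ?case
  proof (rule Ck_on_SucI[OF assms(1)])
    show "((\<lambda>p. inverse (f p)) has_derivative
        (\<lambda>d. - 1 * (inverse (f p) * frechet_derivative f (at p) d * inverse (f p)))) (at p)"
      if "p \<in> S" for p
      using Deriv.has_derivative_inverse[OF assms(3)[OF that] Ck_on_Suc_has_derivative[OF Suc.prems that]]
      by simp
    show "Ck_on k S (\<lambda>p. - 1 * (inverse (f p) * frechet_derivative f (at p) d * inverse (f p)))" for d
      using Suc.prems by (intro Ck_on_mult Ck_on_const assms(1) Suc.IH Ck_on_SucD[OF Suc.prems]) auto
  qed
qed

lemma Ck_on_sqrt:
  fixes f :: "'a::real_normed_vector \<Rightarrow> real"
  assumes "open S" "Ck_on k S f" "\<And>p. p \<in> S \<Longrightarrow> f p > 0"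
  shows "Ck_on k S (\<lambda>p. sqrt (f p))"
  using assms(2)
proof (induction k)
  case 0
  then show ?case by (simp add: continuous_on_real_sqrt)
next
  case (Suc k)
  show ?case
  proof (rule Ck_on_SucI[OF assms(1)])
    show "((\<lambda>p. sqrt (f p)) has_derivative
        (\<lambda>d. frechet_derivative f (at p) d * (inverse (sqrt (f p)) * (1 / 2)))) (at p)"
      if "p \<in> S" for p
      by (rule has_derivative_eq_rhs[OF has_derivative_real_sqrt[OF assms(3)[OF that]
              Ck_on_Suc_has_derivative[OF Suc.prems that]]]) simp
    have ne: "sqrt (f p) \<noteq> 0" if "p \<in> S" for p
      using assms(3)[OF that] by simp
    show "Ck_on k S (\<lambda>p. frechet_derivative f (at p) d * (inverse (sqrt (f p)) * (1 / 2)))" for d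
      by (intro Ck_on_mult Ck_on_const Ck_on_inverse assms(1) ne Suc.IH Ck_on_SucD[OF Suc.prems])
        (use Suc.prems in simp_all)
  qed
qed

text \<open>No induction here: the derivative f'/f no longer contains the logarithm.\<close>

lemma Ck_on_ln:
  fixes f :: "'a::real_normed_vector \<Rightarrow> real"
  assumes "open S" "Ck_on k S f" "\<And>p. p \<in> S \<Longrightarrow> f p > 0"
  shows "Ck_on k S (\<lambda>p. ln (f p))"
proof (cases k)
  case 0
  then show ?thesis using assms(2,3) by (simp add: continuous_on_ln less_imp_neq[symmetric])
next
  case (Suc j)
  then have f: "Ck_on (Suc j) S f" using assms(2) by simp
  have ne: "f p \<noteq> 0" if "p \<in> S" for p
    using assms(3)[OF that] by simp
  show ?thesis unfolding Suc
  proof (rule Ck_on_SucI[OF assms(1)])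
    show "((\<lambda>p. ln (f p)) has_derivative
        (\<lambda>d. frechet_derivative f (at p) d * inverse (f p))) (at p)" if "p \<in> S" for p
      by (rule has_derivative_eq_rhs[OF has_derivative_ln[OF assms(3)[OF that]
              Ck_on_Suc_has_derivative[OF f that]]]) (simp add: field_simps)
    show "Ck_on j S (\<lambda>p. frechet_derivative f (at p) d * inverse (f p))" for d
      using f ne by (intro Ck_on_mult Ck_on_inverse assms(1) Ck_on_SucD[OF f]) auto
  qed
qed

lemma Ck_on_Pair:
  assumes "open S" "Ck_on k S f" "Ck_on k S g"
  shows "Ck_on k S (\<lambda>p. (f p, g p))"
proof -
  have "Ck_on k S (\<lambda>p. (f p, 0) + (0, g p))"
    by (intro Ck_on_add assms(1)
        Ck_on_bounded_linear[OF assms(1) bounded_linear_Pair[OF bounded_linear_ident bounded_linear_zero] assms(2)]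
        Ck_on_bounded_linear[OF assms(1) bounded_linear_Pair[OF bounded_linear_zero bounded_linear_ident] assms(3)])
  then show ?thesis by simp
qed

section \<open>Smooth functions: class C^k for every k\<close>

lemma smooth_on_cong:
  "open S \<Longrightarrow> (\<And>p. p \<in> S \<Longrightarrow> f p = g p) \<Longrightarrow> smooth_on S f \<Longrightarrow> smooth_on S g"
  unfolding smooth_on_def using Ck_on_cong by blast

lemma smooth_on_const: "open S \<Longrightarrow> smooth_on S (\<lambda>p. c)"
  unfolding smooth_on_def using Ck_on_const by blast

lemma smooth_on_add: "open S \<Longrightarrow> smooth_on S f \<Longrightarrow> smooth_on S g \<Longrightarrow> smooth_on S (\<lambda>p. f p + g p)"
  unfolding smooth_on_def using Ck_on_add by blast

lemma smooth_on_sum: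
  "open S \<Longrightarrow> (\<And>i. i \<in> I \<Longrightarrow> smooth_on S (f i)) \<Longrightarrow> smooth_on S (\<lambda>p. \<Sum>i\<in>I. f i p)"
  unfolding smooth_on_def using Ck_on_sum[of S I] by blast

lemma smooth_on_bounded_linear:
  "open S \<Longrightarrow> bounded_linear L \<Longrightarrow> smooth_on S f \<Longrightarrow> smooth_on S (\<lambda>p. L (f p))"
  unfolding smooth_on_def using Ck_on_bounded_linear by blast

lemma smooth_on_minus: "open S \<Longrightarrow> smooth_on S f \<Longrightarrow> smooth_on S (\<lambda>p. - f p)"
  by (rule smooth_on_bounded_linear[OF _ bounded_linear_minus[OF bounded_linear_ident]])

lemma smooth_on_diff:
  "open S \<Longrightarrow> smooth_on S f \<Longrightarrow> smooth_on S g \<Longrightarrow> smooth_on S (\<lambda>p. f p - g p)"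
  using smooth_on_add[of S f "\<lambda>p. - g p"] smooth_on_minus by auto

lemma smooth_on_mult:
  fixes f g :: "'a::real_normed_vector \<Rightarrow> real"
  shows "open S \<Longrightarrow> smooth_on S f \<Longrightarrow> smooth_on S g \<Longrightarrow> smooth_on S (\<lambda>p. f p * g p)"
  unfolding smooth_on_def using Ck_on_mult by blast

lemma smooth_on_divide:
  fixes f g :: "'a::real_normed_vector \<Rightarrow> real"
  shows "open S \<Longrightarrow> smooth_on S f \<Longrightarrow> smooth_on S g \<Longrightarrow> (\<And>p. p \<in> S \<Longrightarrow> g p \<noteq> 0)
    \<Longrightarrow> smooth_on S (\<lambda>p. f p / g p)"
  unfolding smooth_on_def divide_inverse using Ck_on_mult Ck_on_inverse by blast

lemma smooth_on_sqrt:
  fixes f :: "'a::real_normed_vector \<Rightarrow> real"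
  shows "open S \<Longrightarrow> smooth_on S f \<Longrightarrow> (\<And>p. p \<in> S \<Longrightarrow> f p > 0) \<Longrightarrow> smooth_on S (\<lambda>p. sqrt (f p))"
  unfolding smooth_on_def using Ck_on_sqrt by blast

lemma smooth_on_ln:
  fixes f :: "'a::real_normed_vector \<Rightarrow> real"
  shows "open S \<Longrightarrow> smooth_on S f \<Longrightarrow> (\<And>p. p \<in> S \<Longrightarrow> f p > 0) \<Longrightarrow> smooth_on S (\<lambda>p. ln (f p))"
  unfolding smooth_on_def using Ck_on_ln by blast

lemma smooth_on_compose:
  fixes f :: "'a::real_normed_vector \<Rightarrow> 'b::euclidean_space"
    and g :: "'b \<Rightarrow> 'c::real_normed_vector"
  shows "open S \<Longrightarrow> open T \<Longrightarrow> f ` S \<subseteq> T \<Longrightarrow> smooth_on S f \<Longrightarrow> smooth_on T g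
    \<Longrightarrow> smooth_on S (\<lambda>p. g (f p))"
  unfolding smooth_on_def using Ck_on_compose by blast

lemma smooth_on_vec:
  fixes f :: "'k::finite \<Rightarrow> 'a::real_normed_vector \<Rightarrow> real"
  assumes "open S" "\<And>i. smooth_on S (f i)"
  shows "smooth_on S (\<lambda>p. \<chi> i. f i p)"
proof -
  have "smooth_on S (\<lambda>p. \<Sum>i\<in>UNIV. f i p *\<^sub>R axis i (1::real))"
    by (intro smooth_on_sum assms(1) smooth_on_bounded_linear[OF assms(1) bounded_linear_scaleR_left] assms(2))
  moreover have "(\<Sum>i\<in>UNIV. f i p *\<^sub>R axis i (1::real)) = (\<chi> i. f i p)" for p
    by (simp add: vec_eq_iff axis_def if_distrib[where f = "\<lambda>x. _ * x"] sum.delta cong: if_cong)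
  ultimately show ?thesis by simp
qed

lemma Ck_on_subset: "T \<subseteq> S \<Longrightarrow> Ck_on k S f \<Longrightarrow> Ck_on k T f"
  by (induction k arbitrary: f) (auto intro: continuous_on_subset)

lemma smooth_on_subset: "smooth_on S f \<Longrightarrow> T \<subseteq> S \<Longrightarrow> smooth_on T f"
  unfolding smooth_on_def using Ck_on_subset by blast

lemma smooth_on_has_derivative:
  "smooth_on S f \<Longrightarrow> p \<in> S \<Longrightarrow> (f has_derivative frechet_derivative f (at p)) (at p)"
  unfolding smooth_on_def using Ck_on_Suc_has_derivative by blast

lemma smooth_on_frechet_derivative:
  "smooth_on S f \<Longrightarrow> smooth_on S (\<lambda>p. frechet_derivative f (at p) d)"
  unfolding smooth_on_def by (metis Ck_on.simps(2))

lemma smooth_on_imp_continuous_on: "smooth_on S f \<Longrightarrow> continuous_on S f"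
  unfolding smooth_on_def by (metis Ck_on.simps(1))

text \<open>Meant for functions known only through their derivative, such as the potential
  \<open>X\<close> with dX = q dx + qH dt.\<close>

lemma smooth_onI_has_derivative:
  assumes "open S" "\<And>p. p \<in> S \<Longrightarrow> (f has_derivative f' p) (at p)"
    and "\<And>d. smooth_on S (\<lambda>p. f' p d)"
  shows "smooth_on S f"
proof -
  have *: "Ck_on (Suc k) S f" for k
    using assms(3) by (intro Ck_on_SucI[OF assms(1,2)]) (auto simp: smooth_on_def)
  show ?thesis
    unfolding smooth_on_def using * Ck_on_SucD by blast
qed

section \<open>Partial derivatives in the plane\<close>

lemma D1_eqI: "((\<lambda>s. f (s, snd p)) has_real_derivative d) (at (fst p)) \<Longrightarrow> D1 f p = d"
  unfolding D1_def by (rule DERIV_imp_deriv)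

lemma D2_eqI: "((\<lambda>s. f (fst p, s)) has_real_derivative d) (at (snd p)) \<Longrightarrow> D2 f p = d"
  unfolding D2_def by (rule DERIV_imp_deriv)

lemma has_derivative_DERIV1:
  assumes "(f has_derivative f') (at p)"
  shows "((\<lambda>s. f (s, snd p)) has_real_derivative f' (1, 0)) (at (fst p))"
proof -
  interpret bounded_linear f' using assms by (rule has_derivative_bounded_linear)
  have "((\<lambda>s. f (s, snd p)) has_derivative (\<lambda>h. f' (h, 0))) (at (fst p))"
    by (rule has_derivative_compose[where g = f]) (use assms in \<open>auto intro!: derivative_eq_intros\<close>)
  moreover have "h * f' (1, 0) = f' (h, 0)" for h
    using scaleR[of h "(1, 0)"] by simp
  ultimately show ?thesis
    by (rule has_derivative_imp_has_field_derivative)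
qed

lemma has_derivative_DERIV2:
  assumes "(f has_derivative f') (at p)"
  shows "((\<lambda>s. f (fst p, s)) has_real_derivative f' (0, 1)) (at (snd p))"
proof -
  interpret bounded_linear f' using assms by (rule has_derivative_bounded_linear)
  have "((\<lambda>s. f (fst p, s)) has_derivative (\<lambda>h. f' (0, h))) (at (snd p))"
    by (rule has_derivative_compose[where g = f]) (use assms in \<open>auto intro!: derivative_eq_intros\<close>)
  moreover have "h * f' (0, 1) = f' (0, h)" for h
    using scaleR[of h "(0, 1)"] by simp
  ultimately show ?thesis
    by (rule has_derivative_imp_has_field_derivative)
qed

lemma D1_has_derivative: "(f has_derivative f') (at p) \<Longrightarrow> D1 f p = f' (1, 0)"
  by (rule D1_eqI[OF has_derivative_DERIV1])

lemma D2_has_derivative: "(f has_derivative f') (at p) \<Longrightarrow> D2 f p = f' (0, 1)"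
  by (rule D2_eqI[OF has_derivative_DERIV2])

lemma smooth_on_DERIV1:
  assumes "smooth_on S f" "p \<in> S"
  shows "((\<lambda>s. f (s, snd p)) has_real_derivative D1 f p) (at (fst p))"
  using has_derivative_DERIV1[OF smooth_on_has_derivative[OF assms]] D1_eqI by metis

lemma smooth_on_DERIV2:
  assumes "smooth_on S f" "p \<in> S"
  shows "((\<lambda>s. f (fst p, s)) has_real_derivative D2 f p) (at (snd p))"
  using has_derivative_DERIV2[OF smooth_on_has_derivative[OF assms]] D2_eqI by metis

lemma smooth_on_has_derivative_D:
  assumes "smooth_on S f" "p \<in> S"
  shows "(f has_derivative (\<lambda>d. D1 f p * fst d + D2 f p * snd d)) (at p)"
proof -
  let ?f' = "frechet_derivative f (at p)"
  have f: "(f has_derivative ?f') (at p)"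
    by (rule smooth_on_has_derivative[OF assms])
  interpret bounded_linear ?f' using f by (rule has_derivative_bounded_linear)
  have "?f' d = D1 f p * fst d + D2 f p * snd d" for d
  proof -
    have "?f' d = ?f' (fst d *\<^sub>R (1, 0) + snd d *\<^sub>R (0, 1))" by simp
    also have "\<dots> = fst d *\<^sub>R ?f' (1, 0) + snd d *\<^sub>R ?f' (0, 1)" by (simp only: add scaleR)
    finally show ?thesis by (simp add: D1_has_derivative[OF f] D2_has_derivative[OF f])
  qed
  then have "?f' = (\<lambda>d. D1 f p * fst d + D2 f p * snd d)" by (rule ext)
  with f show ?thesis by simp
qed

lemma smooth_on_D1: "open S \<Longrightarrow> smooth_on S f \<Longrightarrow> smooth_on S (D1 f)"
  by (rule smooth_on_cong[OF _ _ smooth_on_frechet_derivative[of S f "(1, 0)"]])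
    (simp_all add: D1_has_derivative[OF smooth_on_has_derivative[of S f]])

lemma smooth_on_D2: "open S \<Longrightarrow> smooth_on S f \<Longrightarrow> smooth_on S (D2 f)"
  by (rule smooth_on_cong[OF _ _ smooth_on_frechet_derivative[of S f "(0, 1)"]])
    (simp_all add: D2_has_derivative[OF smooth_on_has_derivative[of S f]])

text \<open>A slice of an open set is open, so the two functions agree near the point on the line
  along which \<open>D1\<close> differentiates. This permits rewriting under \<open>D1\<close> with
  identities valid only on the domain of a solution.\<close>

lemma D1_cong:
  assumes "open S" "p \<in> S" "\<And>r. r \<in> S \<Longrightarrow> f r = g r"
  shows "D1 f p = D1 g p"
proof -
  have "continuous_on UNIV (\<lambda>s. (s, snd p))" by (intro continuous_intros)
  then have "open ((\<lambda>s. (s, snd p)) -` S)"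
    using assms(1) by (metis continuous_on_open_vimage open_UNIV inf_top_right)
  then have "\<forall>\<^sub>F s in nhds (fst p). f (s, snd p) = g (s, snd p)"
    using assms(2,3) by (intro eventually_nhds_in_open[THEN eventually_mono]) auto
  then show ?thesis unfolding D1_def by (rule deriv_cong_ev) simp
qed

lemma D2_cong:
  assumes "open S" "p \<in> S" "\<And>r. r \<in> S \<Longrightarrow> f r = g r"
  shows "D2 f p = D2 g p"
proof -
  have "continuous_on UNIV (\<lambda>s. (fst p, s))" by (intro continuous_intros)
  then have "open ((\<lambda>s. (fst p, s)) -` S)"
    using assms(1) by (metis continuous_on_open_vimage open_UNIV inf_top_right)
  then have "\<forall>\<^sub>F s in nhds (snd p). f (fst p, s) = g (fst p, s)"
    using assms(2,3) by (intro eventually_nhds_in_open[THEN eventually_mono]) auto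
  then show ?thesis unfolding D2_def by (rule deriv_cong_ev) simp
qed

lemma open_contains_rectangle:
  fixes a b :: real
  assumes "open S" "(a, b) \<in> S"
  obtains d where "d > 0" "{a-d..a+d} \<times> {b-d..b+d} \<subseteq> S"
proof -
  obtain A B where AB: "open A" "open B" "a \<in> A" "b \<in> B" "A \<times> B \<subseteq> S"
    using open_prod_elim[OF assms] by (metis mem_Sigma_iff)
  obtain e f where e: "e > 0" "cball a e \<subseteq> A" and f: "f > 0" "cball b f \<subseteq> B"
    using AB open_contains_cball by metis
  have "{a - min e f..a + min e f} \<times> {b - min e f..b + min e f} \<subseteq> A \<times> B"
  proof (rule Sigma_mono)
    have "{a - min e f..a + min e f} \<subseteq> cball a e" "{b - min e f..b + min e f} \<subseteq> cball b f"
      by (auto simp: cball_eq_atLeastAtMost)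
    with e(2) f(2) show "{a - min e f..a + min e f} \<subseteq> A" "{b - min e f..b + min e f} \<subseteq> B"
      by (blast intro: order_trans)+
  qed
  with AB(5) show ?thesis by (intro that[of "min e f"]) (simp add: e(1) f(1), blast)
qed

text \<open>Differentiating the integral of \<open>D1 f\<close> over {a-d..x} under the integral
  sign shows that \<open>D2 (D1 f)\<close> integrates in the first variable to a difference of
  values of \<open>D2 f\<close>. The fundamental theorem of calculus, applied in x at a, then gives
  the claim.\<close>

lemma D1_D2_commute:
  assumes "open S" "smooth_on S f" "p \<in> S"
  shows "D1 (D2 f) p = D2 (D1 f) p"
proof -
  obtain a b where p: "p = (a, b)" by (cases p)
  obtain d where d: "d > 0" "{a-d..a+d} \<times> {b-d..b+d} \<subseteq> S"
    using open_contains_rectangle assms(1,3) p by metis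
  note sm = assms(2) smooth_on_D1[OF assms(1,2)] smooth_on_D2[OF assms(1,2)]
  have sm12: "smooth_on S (D2 (D1 f))" by (intro smooth_on_D1 smooth_on_D2 assms)
  have *: "integral {a-d..x} (\<lambda>s. D2 (D1 f) (s, b)) = D2 f (x, b) - D2 f (a-d, b)"
    if x: "x \<in> {a-d..a+d}" for x
  proof -
    have sub: "(s, y) \<in> S" if "s \<in> {a-d..x}" "y \<in> {b-d..b+d}" for s y
      using that x by (intro subsetD[OF d(2)]) simp
    have fint: "((\<lambda>s. D1 f (s, y)) has_integral f (x, y) - f (a-d, y)) {a-d..x}"
      if "y \<in> {b-d..b+d}" for y
    proof (rule fundamental_theorem_of_calculus)
      fix s assume "s \<in> {a-d..x}"
      then have "(s, y) \<in> S" using sub that by blast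
      from smooth_on_DERIV1[OF sm(1) this]
      have "((\<lambda>s. f (s, y)) has_vector_derivative D1 f (s, y)) (at s)"
        by (simp only: fst_conv snd_conv has_real_derivative_iff_has_vector_derivative)
      then show "((\<lambda>s. f (s, y)) has_vector_derivative D1 f (s, y)) (at s within {a-d..x})"
        by (rule has_vector_derivative_at_within)
    qed (use x in simp)
    have "((\<lambda>y. integral (cbox (a-d) x) (\<lambda>s. D1 f (s, y))) has_field_derivative
        integral (cbox (a-d) x) (\<lambda>s. D2 (D1 f) (s, b))) (at b within {b-d..b+d})"
    proof (rule leibniz_rule_field_derivative)
      show "((\<lambda>y. D1 f (s, y)) has_real_derivative D2 (D1 f) (s, y)) (at y within {b-d..b+d})"
        if "y \<in> {b-d..b+d}" "s \<in> cbox (a-d) x" for y s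
      proof -
        have "(s, y) \<in> S" using sub that by (simp only: box_real)
        from smooth_on_DERIV2[OF sm(2) this] show ?thesis
          by (simp only: fst_conv snd_conv has_field_derivative_at_within)
      qed
      show "(\<lambda>s. D1 f (s, y)) integrable_on cbox (a-d) x" if "y \<in> {b-d..b+d}" for y
        using has_integral_integrable[OF fint[OF that]] by (simp only: box_real)
      show "continuous_on ({b-d..b+d} \<times> cbox (a-d) x) (\<lambda>(y, s). D2 (D1 f) (s, y))"
        unfolding split_beta
        by (rule continuous_on_compose2[OF smooth_on_imp_continuous_on[OF sm12]])
          (intro continuous_intros, intro image_subsetI sub, simp_all add: mem_Times_iff)
    qed (use d in simp_all)
    then have "((\<lambda>y. f (x, y) - f (a-d, y)) has_field_derivative
        integral (cbox (a-d) x) (\<lambda>s. D2 (D1 f) (s, b))) (at b within {b-d..b+d})"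
      by (rule has_field_derivative_transform_within[OF _ zero_less_one])
        (use d integral_unique[OF fint] in simp_all)
    then have "((\<lambda>y. f (x, y) - f (a-d, y)) has_field_derivative
        integral {a-d..x} (\<lambda>s. D2 (D1 f) (s, b))) (at b)"
      using d by (simp add: at_within_Icc_at)
    moreover have "((\<lambda>y. f (x, y) - f (a-d, y)) has_field_derivative D2 f (x, b) - D2 f (a-d, b)) (at b)"
      using smooth_on_DERIV2[OF sm(1) sub, of x b] smooth_on_DERIV2[OF sm(1) sub, of "a-d" b] x d
      by (intro DERIV_diff) simp_all
    ultimately show ?thesis by (rule DERIV_unique)
  qed
  have "continuous_on {a-d..a+d} (\<lambda>s. D2 (D1 f) (s, b))"
    by (rule continuous_on_compose2[OF smooth_on_imp_continuous_on[OF sm12]])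
      (intro continuous_intros, use d in force)
  then have "((\<lambda>x. integral {a-d..x} (\<lambda>s. D2 (D1 f) (s, b))) has_real_derivative D2 (D1 f) (a, b))
      (at a within {a-d..a+d})"
    by (rule integral_has_real_derivative) (use d in auto)
  then have "((\<lambda>x. D2 f (x, b) - D2 f (a-d, b)) has_real_derivative D2 (D1 f) (a, b))
      (at a within {a-d..a+d})"
    by (rule has_field_derivative_transform_within[OF _ zero_less_one]) (use d * in simp_all)
  then have "((\<lambda>x. D2 f (x, b) - D2 f (a-d, b)) has_real_derivative D2 (D1 f) (a, b)) (at a)"
    using d by (simp add: at_within_Icc_at)
  from DERIV_add[OF this DERIV_const[of "D2 f (a-d, b)"]]
  have "((\<lambda>x. D2 f (x, b)) has_real_derivative D2 (D1 f) (a, b)) (at a)"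
    by simp
  then show ?thesis by (intro D1_eqI) (simp add: p)
qed

section \<open>Rules of differentiation for the two partial derivatives\<close>

lemma D1_const: "D1 (\<lambda>p. c) p = 0"
  by (rule D1_eqI) (rule DERIV_const)

lemma D1_add:
  "smooth_on S f \<Longrightarrow> smooth_on S g \<Longrightarrow> p \<in> S \<Longrightarrow> D1 (\<lambda>r. f r + g r) p = D1 f p + D1 g p"
  by (rule D1_eqI) (rule DERIV_add; rule smooth_on_DERIV1)

lemma D2_add:
  "smooth_on S f \<Longrightarrow> smooth_on S g \<Longrightarrow> p \<in> S \<Longrightarrow> D2 (\<lambda>r. f r + g r) p = D2 f p + D2 g p"
  by (rule D2_eqI) (rule DERIV_add; rule smooth_on_DERIV2)

lemma D1_diff:
  "smooth_on S f \<Longrightarrow> smooth_on S g \<Longrightarrow> p \<in> S \<Longrightarrow> D1 (\<lambda>r. f r - g r) p = D1 f p - D1 g p"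
  by (rule D1_eqI) (rule DERIV_diff; rule smooth_on_DERIV1)

lemma D1_mult:
  assumes "smooth_on S f" "smooth_on S g" "p \<in> S"
  shows "D1 (\<lambda>r. f r * g r) p = D1 f p * g p + D1 g p * f p"
  using DERIV_mult[OF smooth_on_DERIV1[OF assms(1,3)] smooth_on_DERIV1[OF assms(2,3)]]
  by (intro D1_eqI) (simp only: prod.collapse)

lemma D2_mult:
  assumes "smooth_on S f" "smooth_on S g" "p \<in> S"
  shows "D2 (\<lambda>r. f r * g r) p = D2 f p * g p + D2 g p * f p"
  using DERIV_mult[OF smooth_on_DERIV2[OF assms(1,3)] smooth_on_DERIV2[OF assms(2,3)]]
  by (intro D2_eqI) (simp only: prod.collapse)

lemma D1_cmult: "smooth_on S f \<Longrightarrow> p \<in> S \<Longrightarrow> D1 (\<lambda>r. c * f r) p = c * D1 f p"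
  by (rule D1_eqI) (rule DERIV_cmult, rule smooth_on_DERIV1)

lemma D2_cmult: "smooth_on S f \<Longrightarrow> p \<in> S \<Longrightarrow> D2 (\<lambda>r. c * f r) p = c * D2 f p"
  by (rule D2_eqI) (rule DERIV_cmult, rule smooth_on_DERIV2)

lemma D1_divide:
  assumes "smooth_on S f" "smooth_on S g" "p \<in> S" "g p \<noteq> 0"
  shows "D1 (\<lambda>r. f r / g r) p = (D1 f p * g p - f p * D1 g p) / (g p * g p)"
proof -
  have "g (fst p, snd p) \<noteq> 0" using assms(4) by simp
  from DERIV_divide[OF smooth_on_DERIV1[OF assms(1,3)] smooth_on_DERIV1[OF assms(2,3)] this]
  show ?thesis by (intro D1_eqI) (simp only: prod.collapse)
qed

lemma D2_divide:
  assumes "smooth_on S f" "smooth_on S g" "p \<in> S" "g p \<noteq> 0"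
  shows "D2 (\<lambda>r. f r / g r) p = (D2 f p * g p - f p * D2 g p) / (g p * g p)"
proof -
  have "g (fst p, snd p) \<noteq> 0" using assms(4) by simp
  from DERIV_divide[OF smooth_on_DERIV2[OF assms(1,3)] smooth_on_DERIV2[OF assms(2,3)] this]
  show ?thesis by (intro D2_eqI) (simp only: prod.collapse)
qed

lemma D2_const: "D2 (\<lambda>p. c) p = 0"
  by (rule D2_eqI) (rule DERIV_const)

lemma D1_ln:
  assumes "smooth_on S f" "p \<in> S" "f p > 0"
  shows "D1 (\<lambda>r. ln (f r)) p = D1 f p / f p"
proof (rule D1_eqI)
  have "(ln has_real_derivative inverse (f p)) (at (f (fst p, snd p)))"
    using DERIV_ln[OF assms(3)] by simp
  from DERIV_chain2[OF this smooth_on_DERIV1[OF assms(1,2)]]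
  show "((\<lambda>s. ln (f (s, snd p))) has_real_derivative D1 f p / f p) (at (fst p))"
    by (simp only: divide_inverse mult.commute)
qed

lemma D2_ln:
  assumes "smooth_on S f" "p \<in> S" "f p > 0"
  shows "D2 (\<lambda>r. ln (f r)) p = D2 f p / f p"
proof (rule D2_eqI)
  have "(ln has_real_derivative inverse (f p)) (at (f (fst p, snd p)))"
    using DERIV_ln[OF assms(3)] by simp
  from DERIV_chain2[OF this smooth_on_DERIV2[OF assms(1,2)]]
  show "((\<lambda>s. ln (f (fst p, s))) has_real_derivative D2 f p / f p) (at (snd p))"
    by (simp only: divide_inverse mult.commute)
qed

section \<open>Reciprocal transformations\<close>

text \<open>The potential is the integral of \<open>q dx + r dt\<close> along the ray from \<open>p0\<close>. By closedness its
  differentiated integrand in a direction \<open>d\<close> is \<open>d/ds (s (q d\<^sub>1 + r d\<^sub>2))\<close>, which is why \<open>c\<close>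
  below has integral \<open>f p\<close>.\<close>

lemma closed_form_potential:
  fixes q r :: field2
  assumes W: "open W" "convex W" "p0 \<in> W" and q: "smooth_on W q" and r: "smooth_on W r"
    and closed: "\<And>p. p \<in> W \<Longrightarrow> D2 q p = D1 r p"
  shows "\<exists>X. \<forall>p\<in>W. (X has_derivative (\<lambda>d. q p * fst d + r p * snd d)) (at p)"
proof -
  define \<gamma> where "\<gamma> p s = p0 + s *\<^sub>R (p - p0)" for p and s :: real
  define F where "F p s = fst (p - p0) * q (\<gamma> p s) + snd (p - p0) * r (\<gamma> p s)" for p s
  \<comment> \<open>The coordinate forms dx and dt as bounded linear functions: the Leibniz rule for
    total derivatives integrates a function with values in that space.\<close>
  define e1 :: "(real \<times> real) \<Rightarrow>\<^sub>L real" where "e1 = Blinfun fst"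
  define e2 :: "(real \<times> real) \<Rightarrow>\<^sub>L real" where "e2 = Blinfun snd"
  have e: "blinfun_apply e1 d = fst d" "blinfun_apply e2 d = snd d" for d
    unfolding e1_def e2_def by (simp_all add: bounded_linear_Blinfun_apply bounded_linear_fst bounded_linear_snd)
  define c where "c f p s = f (\<gamma> p s) + s * (fst (p - p0) * D1 f (\<gamma> p s) + snd (p - p0) * D2 f (\<gamma> p s))"
    for f and p :: "real \<times> real" and s
  define G where "G p s = c q p s *\<^sub>R e1 + c r p s *\<^sub>R e2" for p s
  have G_apply: "blinfun_apply (G p s) d = c q p s * fst d + c r p s * snd d" for p s d
    by (simp add: G_def blinfun.add_left blinfun.scaleR_left e)
  have \<gamma>: "\<gamma> p s \<in> W" if "p \<in> W" "s \<in> {0..1}" for p s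
  proof -
    have "\<gamma> p s = (1 - s) *\<^sub>R p0 + s *\<^sub>R p" by (simp add: \<gamma>_def algebra_simps)
    then show ?thesis using convexD_alt[OF W(2,3) that(1), of s] that(2) by simp
  qed
  have \<gamma>_der: "((\<lambda>p. \<gamma> p s) has_derivative (\<lambda>d. s *\<^sub>R d)) (at p)" for p s
    unfolding \<gamma>_def by (auto intro!: derivative_eq_intros)
  have \<gamma>_cont: "continuous_on A (\<lambda>z. \<gamma> (fst z) (snd z))" for A
    unfolding \<gamma>_def by (intro continuous_intros)
  have c_int: "((c f p) has_integral f p) {0..1}" if f: "smooth_on W f" and p: "p \<in> W" for f p
  proof -
    have "((\<lambda>s. s * f (\<gamma> p s)) has_real_derivative c f p s) (at s)" if s: "s \<in> {0..1}" for s
    proof -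
      have 1: "((\<lambda>s. \<gamma> p s) has_derivative (\<lambda>h. h *\<^sub>R (p - p0))) (at s)"
        unfolding \<gamma>_def by (auto intro!: derivative_eq_intros)
      have "((\<lambda>s. f (\<gamma> p s)) has_derivative
          (\<lambda>h. D1 f (\<gamma> p s) * fst (h *\<^sub>R (p - p0)) + D2 f (\<gamma> p s) * snd (h *\<^sub>R (p - p0)))) (at s)"
        by (rule has_derivative_compose[OF 1 smooth_on_has_derivative_D[OF f \<gamma>[OF p s]]])
      then have "((\<lambda>s. f (\<gamma> p s)) has_real_derivative
          (fst (p - p0) * D1 f (\<gamma> p s) + snd (p - p0) * D2 f (\<gamma> p s))) (at s)"
        by (rule has_derivative_imp_has_field_derivative) (simp add: algebra_simps)
      from DERIV_mult[OF DERIV_ident this] show ?thesis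
        by (rule DERIV_cong) (simp add: c_def)
    qed
    then have "((\<lambda>s. s * f (\<gamma> p s)) has_vector_derivative c f p s) (at s within {0..1})"
      if "s \<in> {0..1}" for s
      using that by (simp only: has_real_derivative_iff_has_vector_derivative has_vector_derivative_at_within)
    from fundamental_theorem_of_calculus[OF zero_le_one this]
    have "((c f p) has_integral (1 * f (\<gamma> p 1) - 0 * f (\<gamma> p 0))) {0..1}" .
    then show ?thesis by (simp add: \<gamma>_def)
  qed
  have F_der: "((\<lambda>p. F p s) has_derivative blinfun_apply (G p s)) (at p)"
    if "p \<in> W" "s \<in> {0..1}" for p s
  proof -
    note d = has_derivative_compose[OF \<gamma>_der smooth_on_has_derivative_D[OF _ \<gamma>[OF that]]]
    have "((\<lambda>p. F p s) has_derivative (\<lambda>d.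
        (fst (p - p0) * (D1 q (\<gamma> p s) * fst (s *\<^sub>R d) + D2 q (\<gamma> p s) * snd (s *\<^sub>R d)) + fst (d - 0) * q (\<gamma> p s))
      + (snd (p - p0) * (D1 r (\<gamma> p s) * fst (s *\<^sub>R d) + D2 r (\<gamma> p s) * snd (s *\<^sub>R d)) + snd (d - 0) * r (\<gamma> p s)))) (at p)"
      unfolding F_def
      by (intro has_derivative_add has_derivative_mult has_derivative_fst has_derivative_snd
          has_derivative_diff has_derivative_ident has_derivative_const d[OF q] d[OF r])
    \<comment> \<open>Exchanging D2 q and D1 r by closedness turns the coefficient of
      \<open>fst d\<close> into \<open>c q p s\<close> and that of \<open>snd d\<close> into
      \<open>c r p s\<close>.\<close>
    then show ?thesis
      by (rule has_derivative_eq_rhs)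
        (simp add: fun_eq_iff G_apply c_def closed[OF \<gamma>[OF that]] algebra_simps)
  qed
  have cont_c: "continuous_on (W \<times> {0..1}) (\<lambda>z. c f (fst z) (snd z))" if f: "smooth_on W f" for f
  proof -
    have img: "(\<lambda>z. \<gamma> (fst z) (snd z)) ` (W \<times> {0..1}) \<subseteq> W"
      by (intro image_subsetI \<gamma>) (simp_all add: mem_Times_iff)
    note comp = continuous_on_compose2[OF smooth_on_imp_continuous_on \<gamma>_cont img]
    show ?thesis
      unfolding c_def
      by (intro continuous_on_add continuous_on_mult continuous_on_fst continuous_on_snd
          continuous_on_diff continuous_on_id continuous_on_const comp f smooth_on_D1 smooth_on_D2 W(1))
  qed
  have "((\<lambda>p. integral (cbox 0 1) (F p)) has_derivative integral (cbox 0 1) (G p)) (at p)"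
    if p: "p \<in> W" for p
  proof -
    have "((\<lambda>p. integral (cbox 0 1) (F p)) has_derivative integral (cbox 0 1) (G p)) (at p within W)"
    proof (rule leibniz_rule)
      show "((\<lambda>p. F p s) has_derivative blinfun_apply (G p s)) (at p within W)"
        if "p \<in> W" "s \<in> cbox 0 1" for p s
        by (rule has_derivative_at_withinI[OF F_der]) (use that in \<open>simp_all only: box_real\<close>)
      show "F p integrable_on cbox 0 1" if "p \<in> W" for p
      proof (rule integrable_continuous)
        have img: "\<gamma> p ` cbox 0 1 \<subseteq> W"
          using \<gamma>[OF that] by (intro image_subsetI) (simp only: box_real)
        have ct: "continuous_on (cbox 0 1) (\<gamma> p)" unfolding \<gamma>_def by (intro continuous_intros)
        show "continuous_on (cbox 0 1) (F p)"
          unfolding F_def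
          by (intro continuous_on_add continuous_on_mult continuous_on_const
              continuous_on_compose2[OF smooth_on_imp_continuous_on[OF q] ct img]
              continuous_on_compose2[OF smooth_on_imp_continuous_on[OF r] ct img])
      qed
      show "continuous_on (W \<times> cbox 0 1) (\<lambda>(p, s). G p s)"
        unfolding split_beta G_def box_real
        by (intro continuous_on_add continuous_on_scaleR continuous_on_const cont_c q r)
    qed (use p W in simp_all)
    then show ?thesis using at_within_open[OF p W(1)] by simp
  qed
  moreover have "blinfun_apply (integral (cbox 0 1) (G p)) = (\<lambda>d. q p * fst d + r p * snd d)"
    if "p \<in> W" for p
  proof -
    have "(G p has_integral (q p *\<^sub>R e1 + r p *\<^sub>R e2)) (cbox 0 1)"
      unfolding G_def box_real
      by (intro has_integral_add has_integral_scaleR_left c_int q r that)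
    then show ?thesis
      by (simp only: integral_unique) (simp add: fun_eq_iff blinfun.add_left blinfun.scaleR_left e)
  qed
  ultimately show ?thesis by (intro exI[of _ "\<lambda>p. integral (cbox 0 1) (F p)"] ballI) metis
qed

section \<open>Invertibility of the change of variables\<close>

lemma recip_map_has_derivative:
  "(X has_derivative X') (at p) \<Longrightarrow> (recip_map X has_derivative (\<lambda>d. (X' d, snd d))) (at p)"
  unfolding recip_map_def[abs_def]
  by (intro has_derivative_Pair has_derivative_snd has_derivative_ident)

text \<open>Points with the same image share t because T = t. By convexity the horizontal segment
  between them stays in \<open>W\<close>, and X increases strictly along it since its x-derivative q
  is positive.\<close>

lemma inj_on_recip_map:
  assumes "convex W" and X: "\<And>p. p \<in> W \<Longrightarrow> (X has_derivative (\<lambda>d. q p * fst d + r p * snd d)) (at p)"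
    and pos: "\<And>p. p \<in> W \<Longrightarrow> q p > (0::real)"
  shows "inj_on (recip_map X) W"
proof -
  have less: "X (x, t) < X (y, t)" if "x < y" "(x, t) \<in> W" "(y, t) \<in> W" for x y t
  proof (rule DERIV_pos_imp_increasing[OF that(1)])
    fix s assume s: "x \<le> s" "s \<le> y"
    define l where "l = (s - x) / (y - x)"
    have l: "0 \<le> l" "l \<le> 1" and "s = x + l * (y - x)"
      using s that(1) by (simp_all add: l_def)
    then have "(s, t) = (1 - l) *\<^sub>R (x, t) + l *\<^sub>R (y, t)"
      by (simp add: algebra_simps)
    then have st: "(s, t) \<in> W"
      using convexD_alt[OF assms(1) that(2,3) l] by simp
    have "((\<lambda>s. X (s, t)) has_real_derivative q (s, t)) (at s)"
      using has_derivative_DERIV1[OF X[OF st]] by simp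
    with pos[OF st] show "\<exists>d. ((\<lambda>s. X (s, t)) has_real_derivative d) (at s) \<and> d > 0" by blast
  qed
  show ?thesis
  proof (rule inj_onI)
    fix a b assume ab: "a \<in> W" "b \<in> W" "recip_map X a = recip_map X b"
    obtain x t y where [simp]: "a = (x, t)" "b = (y, t)"
      using ab(3) by (cases a; cases b) (simp add: recip_map_def)
    show "a = b"
      using less[of x y t] less[of y x t] ab by (cases x y rule: linorder_cases) (simp_all add: recip_map_def)
  qed
qed

text \<open>The Jacobian matrix has rows (q, r) and (0, 1); the stated derivative is its
  inverse.\<close>

lemma recip_map_inverse_has_derivative:
  assumes "open W" and X: "\<And>p. p \<in> W \<Longrightarrow> (X has_derivative (\<lambda>d. q p * fst d + r p * snd d)) (at p)"
    and inj: "inj_on (recip_map X) W" and p: "p \<in> W" and "q p \<noteq> 0"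
  shows "(inv_into W (recip_map X) has_derivative
    (\<lambda>d. (fst d * inverse (q p) - r p * inverse (q p) * snd d, snd d))) (at (recip_map X p))"
proof (rule has_derivative_inverse_strong[OF assms(1) p])
  show "continuous_on W (recip_map X)"
    using has_derivative_continuous[OF recip_map_has_derivative[OF X]] assms(1)
    by (simp add: continuous_on_eq_continuous_at)
  show "(recip_map X has_derivative (\<lambda>d. (q p * fst d + r p * snd d, snd d))) (at p)"
    by (rule recip_map_has_derivative[OF X[OF p]])
qed (use inj \<open>q p \<noteq> 0\<close> in \<open>simp_all add: fun_eq_iff field_simps\<close>)

text \<open>Bootstrapping: the derivative of the inverse map is a rational expression in q and r
  composed with that same inverse map, so class C^k of the inverse yields class C^(k+1).\<close>

lemma smooth_on_recip_map_inverse: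
  assumes "open W" and X: "\<And>p. p \<in> W \<Longrightarrow> (X has_derivative (\<lambda>d. q p * fst d + r p * snd d)) (at p)"
    and inj: "inj_on (recip_map X) W" and ne: "\<And>p. p \<in> W \<Longrightarrow> q p \<noteq> 0"
    and q: "smooth_on W q" and r: "smooth_on W r"
    and V: "open (recip_map X ` W)"
  shows "smooth_on (recip_map X ` W) (inv_into W (recip_map X))"
proof -
  let ?V = "recip_map X ` W" and ?\<Psi> = "inv_into W (recip_map X)"
  have \<Psi>: "?\<Psi> P \<in> W" "recip_map X (?\<Psi> P) = P" if "P \<in> ?V" for P
    using that by (auto simp: inv_into_into f_inv_into_f)
  then have img: "?\<Psi> ` ?V \<subseteq> W" by blast
  have der: "(?\<Psi> has_derivative (\<lambda>d. (fst d * inverse (q (?\<Psi> P)) -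
      r (?\<Psi> P) * inverse (q (?\<Psi> P)) * snd d, snd d))) (at P)" if "P \<in> ?V" for P
    using recip_map_inverse_has_derivative[OF assms(1) X inj \<Psi>(1)[OF that] ne[OF \<Psi>(1)[OF that]]] \<Psi>(2)[OF that]
    by simp
  have "Ck_on k ?V ?\<Psi>" for k
  proof (induction k)
    case 0
    then show ?case
      using has_derivative_continuous[OF der] V by (simp add: continuous_on_eq_continuous_at)
  next
    case (Suc k)
    have comp: "Ck_on k ?V (\<lambda>P. f (?\<Psi> P))" if "smooth_on W f" for f :: field2
      using that by (intro Ck_on_compose[OF V assms(1) img Suc]) (simp add: smooth_on_def)
    show ?case
    proof (rule Ck_on_SucI[OF V der])
      fix d :: "real \<times> real"
      have "Ck_on k ?V (\<lambda>P. fst d * inverse (q (?\<Psi> P)) + - snd d * (r (?\<Psi> P) * inverse (q (?\<Psi> P))))"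
        using ne[OF \<Psi>(1)]
        by (intro Ck_on_add Ck_on_mult Ck_on_const Ck_on_inverse V comp q r)
      then show "Ck_on k ?V (\<lambda>P. (fst d * inverse (q (?\<Psi> P)) -
          r (?\<Psi> P) * inverse (q (?\<Psi> P)) * snd d, snd d))"
        by (intro Ck_on_Pair Ck_on_const V) (simp add: algebra_simps)
    qed
  qed
  then show ?thesis by (simp add: smooth_on_def)
qed

lemma reciprocal_transformation_exists:
  fixes q H :: field2
  assumes U: "open U" "p \<in> U" and q: "smooth_on U q" and H: "smooth_on U H"
    and pos: "\<And>r. r \<in> U \<Longrightarrow> q r > 0"
    and cons: "\<And>p. p \<in> U \<Longrightarrow> D2 q p = D1 (\<lambda>r. q r * H r) p"
  shows "\<exists>W X. p \<in> W \<and> W \<subseteq> U \<and> reciprocal_transformation q H W X"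
proof -
  obtain a b where p: "p = (a, b)" by (cases p)
  obtain d where d: "d > 0" "{a-d..a+d} \<times> {b-d..b+d} \<subseteq> U"
    using open_contains_rectangle U p by metis
  \<comment> \<open>An open rectangle is convex, which serves twice: for the rays along which the
    potential is integrated and for injectivity.\<close>
  define W where "W = {a-d<..<a+d} \<times> {b-d<..<b+d}"
  have W: "open W" "convex W" "p \<in> W"
    unfolding W_def p using d(1) by (simp_all add: open_Times convex_Times)
  have WU: "W \<subseteq> U"
    using d(2) unfolding W_def by (rule order_trans[rotated]) (intro Sigma_mono; simp add: greaterThanLessThan_subseteq_atLeastAtMost_iff)
  have qW: "smooth_on W q" and rW: "smooth_on W (\<lambda>p. q p * H p)"
    by (intro smooth_on_subset[OF _ WU] smooth_on_mult q H U(1))+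
  have "D2 q s = D1 (\<lambda>p. q p * H p) s" if "s \<in> W" for s
    using cons that WU by blast
  then obtain X where X: "\<And>s. s \<in> W \<Longrightarrow> (X has_derivative (\<lambda>d. q s * fst d + q s * H s * snd d)) (at s)"
    using closed_form_potential[OF W qW rW] by blast
  have posW: "q s > 0" if "s \<in> W" for s using pos that WU by blast
  then have neW: "q s \<noteq> 0" if "s \<in> W" for s using that by (simp add: less_imp_neq[symmetric])
  have inj: "inj_on (recip_map X) W" by (rule inj_on_recip_map[OF W(2) X posW])
  have smX: "smooth_on W X"
    by (rule smooth_onI_has_derivative[OF W(1) X], assumption)
      (intro smooth_on_add smooth_on_mult smooth_on_const W(1) qW smooth_on_subset[OF H WU])
  have "continuous_on W (recip_map X)"
    using has_derivative_continuous[OF recip_map_has_derivative[OF X]] W(1)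
    by (simp add: continuous_on_eq_continuous_at)
  \<comment> \<open>Openness of the image follows from continuity and injectivity in equal
    dimensions.\<close>
  then have V: "open (recip_map X ` W)"
    by (rule invariance_of_domain[OF _ W(1) inj])
  have "reciprocal_transformation q H W X"
    unfolding reciprocal_transformation_def
    using W(1) neW cons WU smX inj V smooth_on_recip_map_inverse[OF W(1) X inj neW qW rW V] X
    by blast
  then show ?thesis using W(3) WU by blast
qed

section \<open>Functions and their derivatives in the variables (X, T)\<close>

lemma reciprocal_inverse:
  assumes "P \<in> recip_map X ` W"
  shows "inv_into W (recip_map X) P \<in> W" "recip_map X (inv_into W (recip_map X) P) = P"
  by (rule inv_into_into[OF assms], rule f_inv_into_f[OF assms])

lemma smooth_on_pushforward:
  assumes rt: "reciprocal_transformation q H W X" and f: "smooth_on W f"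
  shows "smooth_on (recip_map X ` W) (pushforward W X f)"
proof -
  have "open (recip_map X ` W)" "open W" "smooth_on (recip_map X ` W) (inv_into W (recip_map X))"
    using rt unfolding reciprocal_transformation_def by blast+
  moreover have "inv_into W (recip_map X) ` recip_map X ` W \<subseteq> W"
    using reciprocal_inverse(1) by blast
  ultimately show ?thesis
    unfolding pushforward_def[abs_def] by (metis smooth_on_compose f)
qed

text \<open>These are the rules D_x = q D_X and D_t = D_T + qH D_X solved for the new derivatives:
  D_X = D_x / q and D_T = D_t - H D_x.\<close>

lemma pushforward_has_derivative:
  assumes rt: "reciprocal_transformation q H W X" and f: "smooth_on W f" and P: "P \<in> recip_map X ` W"
  shows "(pushforward W X f has_derivative (\<lambda>d. pushforward W X (D1 f) P / pushforward W X q P * fst d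
    + (pushforward W X (D2 f) P - pushforward W X H P * pushforward W X (D1 f) P) * snd d)) (at P)"
proof -
  let ?\<Psi> = "inv_into W (recip_map X)"
  note \<Psi> = reciprocal_inverse[OF P]
  have W: "open W" and X: "\<And>p. p \<in> W \<Longrightarrow> (X has_derivative (\<lambda>d. q p * fst d + q p * H p * snd d)) (at p)"
    and inj: "inj_on (recip_map X) W" and ne: "q (?\<Psi> P) \<noteq> 0"
    using rt \<Psi>(1) unfolding reciprocal_transformation_def by simp_all
  have "(?\<Psi> has_derivative (\<lambda>d. (fst d * inverse (q (?\<Psi> P)) -
      q (?\<Psi> P) * H (?\<Psi> P) * inverse (q (?\<Psi> P)) * snd d, snd d))) (at P)"
    using recip_map_inverse_has_derivative[OF W X inj \<Psi>(1) ne] by (simp only: \<Psi>(2))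
  from has_derivative_compose[OF this smooth_on_has_derivative_D[OF f \<Psi>(1)]]
  show ?thesis
    unfolding pushforward_def[abs_def]
    by (rule has_derivative_eq_rhs) (use ne in \<open>simp add: fun_eq_iff field_simps\<close>)
qed

lemma D1_pushforward:
  assumes "reciprocal_transformation q H W X" "smooth_on W f" "P \<in> recip_map X ` W"
  shows "D1 (pushforward W X f) P = pushforward W X (D1 f) P / pushforward W X q P"
  using D1_has_derivative[OF pushforward_has_derivative[OF assms]] by simp

lemma D2_pushforward:
  assumes "reciprocal_transformation q H W X" "smooth_on W f" "P \<in> recip_map X ` W"
  shows "D2 (pushforward W X f) P =
    pushforward W X (D2 f) P - pushforward W X H P * pushforward W X (D1 f) P"
  using D2_has_derivative[OF pushforward_has_derivative[OF assms]] by simp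

section \<open>The fields in the new variables\<close>

text \<open>Everything that the computation in (X, T) uses, detached from u, v and the old
  coordinates. \<open>S\<close> is the sign sigma; \<open>Q_T\<close> is (1/q)_T = - H_X cleared of
  denominators, and \<open>K_T\<close> is the equation for log kappa multiplied by kappa.\<close>

locale transformed_fields =
  fixes V :: "(real \<times> real) set" and Q K S A B H :: field2
  assumes V: "open V"
    and sm: "smooth_on V Q" "smooth_on V K" "smooth_on V S" "smooth_on V A" "smooth_on V B" "smooth_on V H"
    and Q_pos: "\<And>P. P \<in> V \<Longrightarrow> Q P > 0" and K_pos: "\<And>P. P \<in> V \<Longrightarrow> K P > 0"
    and S_sq: "\<And>P. P \<in> V \<Longrightarrow> S P * S P = 1"
    and A_X: "\<And>P. P \<in> V \<Longrightarrow> D1 A P = S P / K P - A P / Q P"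
    and B_X: "\<And>P. P \<in> V \<Longrightarrow> D1 B P = B P / Q P - S P * K P"
    and Q_T: "\<And>P. P \<in> V \<Longrightarrow> D2 Q P = Q P * Q P * D1 H P"
    and K_T: "\<And>P. P \<in> V \<Longrightarrow> D2 K P = - K P * (H P + 2 * (A P * B P))"
begin

definition a :: field2 where "a P = S P * K P * A P"
definition b :: field2 where "b P = S P * B P / K P"

abbreviation \<theta> :: field2 where "\<theta> \<equiv> theta_field Q K"

lemma ne: "P \<in> V \<Longrightarrow> Q P \<noteq> 0" "P \<in> V \<Longrightarrow> K P \<noteq> 0"
  using Q_pos[of P] K_pos[of P] by auto

text \<open>Differentiating S^2 = 1 gives S S_X = 0, and multiplying by S removes the
  factor.\<close>

lemma S_X: assumes P: "P \<in> V" shows "D1 S P = 0"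
proof -
  have "D1 (\<lambda>P. S P * S P) P = D1 (\<lambda>P. 1) P" by (rule D1_cong[OF V P]) (rule S_sq)
  then have "D1 S P * S P + D1 S P * S P = 0"
    by (simp only: D1_mult[OF sm(3,3) P] D1_const)
  then have "D1 S P * (S P * S P) = 0" by auto
  then show ?thesis unfolding S_sq[OF P] by simp
qed

lemma smooth_theta: "smooth_on V \<theta>"
  unfolding theta_field_def[abs_def]
  by (intro smooth_on_add smooth_on_mult smooth_on_divide smooth_on_const smooth_on_D1 smooth_on_ln
      sm K_pos V) (simp_all only: mult_eq_0_iff ne, simp_all)

lemma theta_eq: "P \<in> V \<Longrightarrow> \<theta> P = - 1 / (2 * Q P) + 1/2 * (D1 K P / K P)"
  unfolding theta_field_def using D1_ln[OF sm(2) _ K_pos] by simp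

lemma smooth_a: "smooth_on V a" and smooth_b: "smooth_on V b"
  unfolding a_def[abs_def] b_def[abs_def]
  by (intro smooth_on_mult smooth_on_divide ne sm V)+

text \<open>In the logarithmic derivative, kappa contributes kappa_X/kappa and A contributes -1/q;
  their sum is 2 theta. For b both contributions have the opposite sign.\<close>

lemma a_X: assumes P: "P \<in> V" shows "D1 a P = 1 + 2 * \<theta> P * a P"
proof -
  note sSK = smooth_on_mult[OF V sm(3,2)]
  have "D1 a P = D1 K P * S P * A P + D1 A P * (S P * K P)"
    unfolding a_def[abs_def] by (simp add: D1_mult[OF sSK sm(4) P] D1_mult[OF sm(3,2) P] S_X[OF P])
  also have "D1 A P * (S P * K P) = S P * S P - S P * K P * A P / Q P"
    unfolding A_X[OF P] using ne[OF P] by (simp add: field_simps)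
  also have "D1 K P * S P * A P + (S P * S P - S P * K P * A P / Q P) = 1 + 2 * \<theta> P * a P"
    unfolding S_sq[OF P] theta_eq[OF P] a_def using ne[OF P] by (simp add: field_simps)
  finally show ?thesis .
qed

lemma b_X: assumes P: "P \<in> V" shows "D1 b P = - 2 * \<theta> P * b P - 1"
proof -
  note sSB = smooth_on_mult[OF V sm(3,5)]
  have "D1 b P = (D1 B P * S P * K P - S P * B P * D1 K P) / (K P * K P)"
    unfolding b_def[abs_def]
    by (simp add: D1_divide[OF sSB sm(2) P ne(2)[OF P]] D1_mult[OF sm(3,5) P] S_X[OF P])
  also have "\<dots> = S P * B P / (Q P * K P) - S P * S P - S P * B P * D1 K P / (K P * K P)"
    unfolding B_X[OF P] using ne[OF P] by (simp add: field_simps)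
  also have "\<dots> = - 2 * \<theta> P * b P - 1"
    unfolding S_sq[OF P] theta_eq[OF P] b_def using ne[OF P] by (simp add: field_simps)
  finally show ?thesis .
qed

text \<open>The term -1/(2q) contributes H_X/2, and (log kappa)_X/2 contributes -H_X/2 - (AB)_X
  after the mixed derivatives are exchanged. The cancellation of H_X is why the equation for theta
  does not depend on the choice of H.\<close>

lemma theta_T: assumes P: "P \<in> V" shows "D2 \<theta> P = a P - b P"
proof -
  let ?L = "\<lambda>P. ln (K P)"
  have sL: "smooth_on V ?L" by (intro smooth_on_ln V sm K_pos)
  have sAB: "smooth_on V (\<lambda>P. A P * B P)" by (intro smooth_on_mult V sm)
  have sc: "smooth_on V (\<lambda>P. c)" for c :: real by (rule smooth_on_const[OF V])
  have L_T: "D2 ?L R = - 1 * (H R + 2 * (A R * B R))" if "R \<in> V" for R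
    unfolding D2_ln[OF sm(2) that K_pos[OF that]] K_T[OF that] using ne(2)[OF that] by simp
  have s2: "smooth_on V (\<lambda>P. 2 * Q P)" and s2AB: "smooth_on V (\<lambda>P. 2 * (A P * B P))"
    by (intro smooth_on_mult sc sm V)+
  have "D2 (D1 ?L) P = D1 (D2 ?L) P" by (rule D1_D2_commute[OF V sL P, symmetric])
  also have "\<dots> = D1 (\<lambda>R. - 1 * (H R + 2 * (A R * B R))) P" by (rule D1_cong[OF V P L_T])
  also have "\<dots> = - 1 * (D1 H P + 2 * (D1 A P * B P + D1 B P * A P))"
    by (simp only: D1_cmult[OF smooth_on_add[OF V sm(6) s2AB] P] D1_add[OF sm(6) s2AB P]
        D1_cmult[OF sAB P] D1_mult[OF sm(4,5) P])
  finally have L_XT: "D2 (D1 ?L) P = - D1 H P - 2 * (D1 A P * B P + D1 B P * A P)" by simp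
  have n2: "2 * Q P \<noteq> 0" using ne(1)[OF P] by simp
  have "D2 (\<lambda>P. - 1 / (2 * Q P)) P = D1 H P / 2"
    using ne(1)[OF P]
    by (simp only: D2_divide[OF sc s2 P n2] D2_const D2_cmult[OF sm(1) P] Q_T[OF P])
      (simp add: field_simps)
  moreover have "smooth_on V (\<lambda>P. - 1 / (2 * Q P))" "smooth_on V (\<lambda>P. 1/2 * D1 ?L P)"
    using ne(1) by (intro smooth_on_divide smooth_on_mult smooth_on_D1 sc sm sL V; simp)+
  ultimately have "D2 \<theta> P = D1 H P / 2 + 1/2 * D2 (D1 ?L) P"
    unfolding theta_field_def[abs_def]
    by (simp only: D2_add[OF _ _ P] D2_cmult[OF smooth_on_D1[OF V sL] P])
  also have "\<dots> = - (D1 A P * B P + D1 B P * A P)"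
    unfolding L_XT by (simp add: field_simps)
  also have "\<dots> = a P - b P"
    using ne[OF P] by (simp add: A_X[OF P] B_X[OF P] a_def b_def field_simps)
  finally show ?thesis .
qed

lemma theta_TX: assumes P: "P \<in> V" shows "D1 (D2 \<theta>) P = 2 + 2 * \<theta> P * (a P + b P)"
proof -
  have "D1 (D2 \<theta>) P = D1 (\<lambda>P. a P - b P) P" by (rule D1_cong[OF V P theta_T])
  then show ?thesis
    by (simp only: D1_diff[OF smooth_a smooth_b P] a_X[OF P] b_X[OF P]) (simp add: algebra_simps)
qed

text \<open>The target equation contains \<open>D2 (D1 \<theta>)\<close>, while expressions can only
  form \<open>DX ThetaT\<close>; hence both orders of differentiation are recorded.\<close>

lemma theta_XT: "P \<in> V \<Longrightarrow> D2 (D1 \<theta>) P = 2 + 2 * \<theta> P * (a P + b P)"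
  using D1_D2_commute[OF V smooth_theta] theta_TX by simp

text \<open>Here (theta_XT - 2)/(2 theta) is a + b and theta_T is a - b; half the sum is a, half the
  difference is b. The arithmetic is written exactly as \<open>a_expr\<close> and
  \<open>b_expr\<close> evaluate.\<close>

lemma a_eq: "P \<in> V \<Longrightarrow> \<theta> P \<noteq> 0 \<Longrightarrow> 1/2 * ((D1 (D2 \<theta>) P + - 2) / (2 * \<theta> P) + D2 \<theta> P) = a P"
  by (simp add: theta_TX theta_T field_simps)

lemma b_eq: "P \<in> V \<Longrightarrow> \<theta> P \<noteq> 0 \<Longrightarrow> 1/2 * ((D1 (D2 \<theta>) P + - 2) / (2 * \<theta> P) + - 1 * D2 \<theta> P) = b P"
  by (simp add: theta_TX theta_T field_simps)

lemma theta_equation: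
  assumes \<theta>: "\<And>P. P \<in> V \<Longrightarrow> \<theta> P \<noteq> 0" and P: "P \<in> V"
  shows "D2 \<theta> P + 1/4 * D1 (\<lambda>R. (D2 (D1 \<theta>) R - 2)\<^sup>2 / (4 * (\<theta> R)\<^sup>2) - (D2 \<theta> R)\<^sup>2) P = 0"
proof -
  have "(D2 (D1 \<theta>) R - 2)\<^sup>2 / (4 * (\<theta> R)\<^sup>2) - (D2 \<theta> R)\<^sup>2 = 4 * (a R * b R)" if "R \<in> V" for R
    using \<theta>[OF that] by (simp add: theta_XT[OF that] theta_T[OF that] power2_eq_square field_simps)
  then have "D1 (\<lambda>R. (D2 (D1 \<theta>) R - 2)\<^sup>2 / (4 * (\<theta> R)\<^sup>2) - (D2 \<theta> R)\<^sup>2) P = D1 (\<lambda>R. 4 * (a R * b R)) P"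
    by (rule D1_cong[OF V P])
  also have "\<dots> = 4 * (D1 a P * b P + D1 b P * a P)"
    by (simp only: D1_cmult[OF smooth_on_mult[OF V smooth_a smooth_b] P] D1_mult[OF smooth_a smooth_b P])
  \<comment> \<open>The terms with theta a b cancel, which leaves (ab)_X = b - a.\<close>
  also have "\<dots> = 4 * (b P - a P)"
    by (simp add: a_X[OF P] b_X[OF P] algebra_simps)
  finally have eq: "D1 (\<lambda>R. (D2 (D1 \<theta>) R - 2)\<^sup>2 / (4 * (\<theta> R)\<^sup>2) - (D2 \<theta> R)\<^sup>2) P = 4 * (b P - a P)" .
  show ?thesis unfolding eq theta_T[OF P] by (simp add: field_simps)
qed

text \<open>The weights sigma kappa and sigma/kappa of a and b multiply to sigma^2 = 1, so ab =
  AB.\<close>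

lemma kappa_equation: assumes P: "P \<in> V" shows "D2 K P + K P * (H P + 2 * (a P * b P)) = 0"
proof -
  have "a P * b P = (S P * S P) * (A P * B P)"
    using ne(2)[OF P] by (simp add: a_def b_def)
  then show ?thesis unfolding S_sq[OF P] K_T[OF P] by simp
qed

lemma Q_eq: "P \<in> V \<Longrightarrow> D1 K P / K P + - 2 * \<theta> P = 1 / Q P"
  by (simp add: theta_eq)

text \<open>This and \<open>B_eq\<close> justify the right-hand sides of the linear equations that
  define the nonlocal u and v.\<close>

lemma A_eq: assumes P: "P \<in> V" shows "S P * a P / K P = A P"
proof -
  have "S P * a P / K P = (S P * S P) * A P"
    using ne(2)[OF P] by (simp add: a_def)
  then show ?thesis unfolding S_sq[OF P] by simp
qed

lemma B_eq: assumes P: "P \<in> V" shows "S P * b P * K P = B P"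
proof -
  have "S P * b P * K P = (S P * S P) * B P"
    using ne(2)[OF P] by (simp add: b_def)
  then show ?thesis unfolding S_sq[OF P] by simp
qed

end

section \<open>The nonlocal expression for the evolution of kappa\<close>

text \<open>Writing (log kappa)_X as kappa_X/kappa keeps the expression rational; its value is given
  by \<open>Q_eq\<close>.\<close>

definition q_expr :: "('k::finite) dexpr" where
  "q_expr = Div (Const 1) (Add (Div (DX Kappa) Kappa) (Mul (Const (- 2)) Theta))"

definition a_expr :: "('k::finite) dexpr" where
  "a_expr = Mul (Const (1/2))
     (Add (Div (Add (DX ThetaT) (Const (- 2))) (Mul (Const 2) Theta)) ThetaT)"

definition b_expr :: "('k::finite) dexpr" where
  "b_expr = Mul (Const (1/2))
     (Add (Div (Add (DX ThetaT) (Const (- 2))) (Mul (Const 2) Theta)) (Mul (Const (- 1)) ThetaT))"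

text \<open>The operator D_x = q D_X, which rebuilds x-derivatives from functions of (X, T).\<close>

definition dx_expr :: "('k::finite) dexpr \<Rightarrow> 'k dexpr" where
  "dx_expr e = Mul q_expr (DX e)"

text \<open>The factors 2 and -2 undo the rescaling, since h takes the jets of the original u and
  v.\<close>

primrec jet_expr :: "jetvar \<Rightarrow> ('k::finite) dexpr" where
  "jet_expr (Ujet j) = (dx_expr ^^ j) (Mul (Const 2) (Nonloc 1))"
| "jet_expr (Vjet j) = (dx_expr ^^ j) (Mul (Const (- 2)) (Nonloc 2))"

text \<open>The nonlocal variables are the sign \<open>\<sigma>\<close> of \<open>m\<close>, which the fields \<open>q, \<kappa>\<close> do not see, and
  the rescaled \<open>u\<close> and \<open>v\<close>.\<close>

definition nonlocal_eqs :: "(('k::finite) dexpr list \<times> 'k dexpr) list" where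
  "nonlocal_eqs =
    [([Const 0, Const 1], Const 0),
     ([Const 1, Mul (Const (- 1)) q_expr], Div (Mul (Nonloc 0) a_expr) Kappa),
     ([Const 1, q_expr], Mul (Mul (Nonloc 0) b_expr) Kappa)]"

text \<open>Built from \<open>h\<close>, \<open>\<Omega>\<close> and \<open>J\<close> alone, so that
  one function F serves all solutions.\<close>

definition kappa_rate :: "(real ^ 'k \<Rightarrow> real) \<Rightarrow> (real ^ 'k) set \<Rightarrow> ('k::finite \<Rightarrow> jetvar) \<Rightarrow> 'k nonlocal_fun" where
  "kappa_rate h \<Omega> J = (nonlocal_eqs,
     Add (Fn h \<Omega> (\<lambda>i. jet_expr (J i))) (Mul (Const 2) (Mul a_expr b_expr)))"

section \<open>Well-formedness and values of the expressions\<close>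

lemma wf_q_expr: "wf_dexpr r q_expr" and wf_a_expr: "wf_dexpr r a_expr" and wf_b_expr: "wf_dexpr r b_expr"
  by (simp_all add: q_expr_def a_expr_def b_expr_def)

lemma wf_dx_expr_funpow: "wf_dexpr r e \<Longrightarrow> wf_dexpr r ((dx_expr ^^ j) e)"
  by (induction j) (simp_all add: dx_expr_def wf_q_expr)

lemma wf_jet_expr: "2 < r \<Longrightarrow> wf_dexpr r (jet_expr z)"
  by (cases z) (simp_all add: wf_dx_expr_funpow)

lemma wf_kappa_rate: "open \<Omega> \<Longrightarrow> smooth_on \<Omega> h \<Longrightarrow> wf_nonlocal (kappa_rate h \<Omega> J)"
  unfolding wf_nonlocal_def kappa_rate_def nonlocal_eqs_def
  by (simp add: wf_q_expr wf_a_expr wf_b_expr wf_jet_expr less_Suc_eq nth_Cons split: nat.splits)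

context transformed_fields
begin

lemma deval_q_expr: "P \<in> V \<Longrightarrow> deval \<theta> K w q_expr P = Q P"
  using Q_eq by (simp add: q_expr_def)

lemma defined_q_expr: "defined_on V \<theta> K w q_expr"
  using Q_eq ne by (simp add: q_expr_def)

context
  assumes theta_ne: "\<And>P. P \<in> V \<Longrightarrow> \<theta> P \<noteq> 0"
begin

lemma deval_a_expr: "P \<in> V \<Longrightarrow> deval \<theta> K w a_expr P = a P"
  unfolding a_expr_def deval.simps by (rule a_eq[OF _ theta_ne])

lemma deval_b_expr: "P \<in> V \<Longrightarrow> deval \<theta> K w b_expr P = b P"
  unfolding b_expr_def deval.simps by (rule b_eq[OF _ theta_ne])

lemma defined_a_expr: "defined_on V \<theta> K w a_expr" and defined_b_expr: "defined_on V \<theta> K w b_expr"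
  using theta_ne by (simp_all add: a_expr_def b_expr_def)

end

end

lemma smooth_on_D1_funpow: "open S \<Longrightarrow> smooth_on S f \<Longrightarrow> smooth_on S ((D1 ^^ j) f)"
  by (induction j) (simp_all add: smooth_on_D1)

lemma defined_dx_expr_funpow:
  fixes e :: "('k::finite) dexpr"
  shows "defined_on V \<theta> K w (q_expr :: 'k dexpr) \<Longrightarrow> defined_on V \<theta> K w e
    \<Longrightarrow> defined_on V \<theta> K w ((dx_expr ^^ j) e)"
  by (induction j) (simp_all add: dx_expr_def)

text \<open>Each application of q D_X to a transported function is the transport of its
  x-derivative. Agreement on the open image is enough to replace the function under
  \<open>D1\<close>.\<close>

lemma deval_dx_expr_funpow:
  fixes e :: "('k::finite) dexpr"
  assumes rt: "reciprocal_transformation q H W X" and f: "smooth_on W f"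
    and q: "\<And>P. P \<in> recip_map X ` W \<Longrightarrow> deval \<theta> K w (q_expr :: 'k dexpr) P = pushforward W X q P"
    and e: "\<And>P. P \<in> recip_map X ` W \<Longrightarrow> deval \<theta> K w e P = pushforward W X f P"
    and P: "P \<in> recip_map X ` W"
  shows "deval \<theta> K w ((dx_expr ^^ j) e) P = pushforward W X ((D1 ^^ j) f) P"
  using P
proof (induction j arbitrary: P)
  case 0
  then show ?case using e by simp
next
  case (Suc j)
  have W: "open W" "open (recip_map X ` W)" and q_ne: "pushforward W X q P \<noteq> 0"
    using rt reciprocal_inverse(1)[OF Suc.prems] unfolding reciprocal_transformation_def pushforward_def
    by blast+
  have "deval \<theta> K w ((dx_expr ^^ Suc j) e) P
      = pushforward W X q P * D1 (deval \<theta> K w ((dx_expr ^^ j) e)) P"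
    by (simp add: dx_expr_def q[OF Suc.prems])
  also have "D1 (deval \<theta> K w ((dx_expr ^^ j) e)) P = D1 (pushforward W X ((D1 ^^ j) f)) P"
    by (rule D1_cong[OF W(2) Suc.prems Suc.IH])
  also have "\<dots> = pushforward W X (D1 ((D1 ^^ j) f)) P / pushforward W X q P"
    by (rule D1_pushforward[OF rt smooth_on_D1_funpow[OF W(1) f] Suc.prems])
  finally show ?case using q_ne by simp
qed

section \<open>Solutions of the system\<close>

text \<open>The condition mn > 0 makes both radicands positive, so that q and kappa are smooth and
  do not vanish.\<close>

locale positive_solution =
  fixes h :: "real ^ 'k \<Rightarrow> real" and \<Omega> :: "(real ^ 'k) set" and J :: "'k::finite \<Rightarrow> jetvar"
    and U :: "(real \<times> real) set" and u v :: field2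
  assumes \<Omega>: "open \<Omega>" and h: "smooth_on \<Omega> h"
    and sol: "is_solution h \<Omega> J U u v"
    and pos: "\<And>p. p \<in> U \<Longrightarrow> m_resc u p * n_resc v p > 0"
begin

abbreviation "m \<equiv> m_resc u"
abbreviation "n \<equiv> n_resc v"
abbreviation "q \<equiv> q_field u v"
abbreviation "\<kappa> \<equiv> kappa_field u v"
abbreviation "H \<equiv> Hfield h J u v"

definition A :: field2 where "A p = 1/2 * (u p - D1 u p)"
definition B :: field2 where "B p = - 1/2 * (v p + D1 v p)"
definition u_resc :: field2 where "u_resc p = 1/2 * u p"
definition v_resc :: field2 where "v_resc p = - 1/2 * v p"
text \<open>The sign of m, written as a quotient so that its smoothness is immediate; its square is
  m^2 (n/m) / (mn) = 1.\<close>

definition \<sigma> :: field2 where "\<sigma> p = m p * \<kappa> p / q p"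

lemma U: "open U" and u: "smooth_on U u" and v: "smooth_on U v"
  using sol by (simp_all add: is_solution_def)

lemma m_eq: "p \<in> U \<Longrightarrow> m p = 1/2 * momentum u p"
  and n_eq: "p \<in> U \<Longrightarrow> n p = - 1/2 * momentum v p"
proof -
  have *: "momentum (\<lambda>p. c * w p) p = c * momentum w p" if p: "p \<in> U" and w: "smooth_on U w" for c w p
  proof -
    have "D1 (D1 (\<lambda>p. c * w p)) p = D1 (\<lambda>p. c * D1 w p) p"
      by (rule D1_cong[OF U p D1_cmult[OF w]])
    also have "\<dots> = c * D1 (D1 w) p"
      by (rule D1_cmult[OF smooth_on_D1[OF U w] p])
    finally show ?thesis by (simp add: momentum_def algebra_simps)
  qed
  show "p \<in> U \<Longrightarrow> m p = 1/2 * momentum u p"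
    using *[OF _ u, of p "1/2"] by (simp add: m_resc_def)
  show "p \<in> U \<Longrightarrow> n p = - 1/2 * momentum v p"
    using *[OF _ v, of p "- 1/2"] by (simp add: n_resc_def)
qed

lemma smooth_momentum: "smooth_on U w \<Longrightarrow> smooth_on U (momentum w)"
  unfolding momentum_def[abs_def] by (intro smooth_on_diff smooth_on_D1 U)

lemma smooth_m: "smooth_on U m"
  by (rule smooth_on_cong[OF U m_eq[symmetric]], assumption)
    (intro smooth_on_mult smooth_on_const smooth_momentum u U)

lemma smooth_n: "smooth_on U n"
  by (rule smooth_on_cong[OF U n_eq[symmetric]], assumption)
    (intro smooth_on_mult smooth_on_const smooth_momentum v U)

lemma smooth_A: "smooth_on U A" and smooth_B: "smooth_on U B"
  unfolding A_def[abs_def] B_def[abs_def]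
  by (intro smooth_on_mult smooth_on_const smooth_on_diff smooth_on_add smooth_on_D1 u v U)+

lemma smooth_u_resc: "smooth_on U u_resc" and smooth_v_resc: "smooth_on U v_resc"
  unfolding u_resc_def[abs_def] v_resc_def[abs_def] by (intro smooth_on_mult smooth_on_const u v U)+

lemma u_resc_x: "p \<in> U \<Longrightarrow> D1 u_resc p = 1/2 * D1 u p" and v_resc_x: "p \<in> U \<Longrightarrow> D1 v_resc p = - 1/2 * D1 v p"
  unfolding u_resc_def[abs_def] v_resc_def[abs_def] by (rule D1_cmult[OF u], assumption, rule D1_cmult[OF v])

lemma smooth_jet: "smooth_on U (jet_val u v z)"
  by (cases z) (simp_all add: smooth_on_D1_funpow U u v)

lemma smooth_H: "smooth_on U H"
proof -
  have "smooth_on U (jet_point J u v)"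
    unfolding jet_point_def[abs_def] by (intro smooth_on_vec U smooth_jet)
  moreover have "jet_point J u v ` U \<subseteq> \<Omega>"
    using sol by (auto simp: is_solution_def)
  ultimately show ?thesis
    unfolding Hfield_def[abs_def] by (metis smooth_on_compose U \<Omega> h)
qed

lemma m_ne: "p \<in> U \<Longrightarrow> m p \<noteq> 0" and n_ne: "p \<in> U \<Longrightarrow> n p \<noteq> 0"
  using pos[of p] by auto

lemma q_pos: "p \<in> U \<Longrightarrow> q p > 0" and q_sq: "p \<in> U \<Longrightarrow> q p * q p = m p * n p"
  using pos[of p] by (simp_all add: q_field_def)

lemma ratio_pos: "p \<in> U \<Longrightarrow> n p / m p > 0"
  using pos[of p] by (auto simp: zero_less_divide_iff zero_less_mult_iff)

lemma kappa_pos: "p \<in> U \<Longrightarrow> \<kappa> p > 0"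
  using ratio_pos by (simp only: kappa_field_def real_sqrt_gt_zero)

lemma kappa_sq: assumes p: "p \<in> U" shows "\<kappa> p * \<kappa> p = n p / m p"
  unfolding kappa_field_def using ratio_pos[OF p] by (intro real_sqrt_mult_self[THEN trans]) (rule abs_of_pos)

lemma smooth_q: "smooth_on U q"
  unfolding q_field_def[abs_def] by (intro smooth_on_sqrt smooth_on_mult smooth_m smooth_n U pos)

lemma smooth_kappa: "smooth_on U \<kappa>"
  unfolding kappa_field_def[abs_def]
  by (intro smooth_on_sqrt smooth_on_divide smooth_m smooth_n U ratio_pos m_ne)

lemma q_ne: "p \<in> U \<Longrightarrow> q p \<noteq> 0" and kappa_ne: "p \<in> U \<Longrightarrow> \<kappa> p \<noteq> 0"
  using q_pos[of p] kappa_pos[of p] by auto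

lemma smooth_sigma: "smooth_on U \<sigma>"
  unfolding \<sigma>_def[abs_def]
  by (intro smooth_on_divide smooth_on_mult smooth_m smooth_q smooth_kappa U q_ne)

lemma sigma_sq: assumes p: "p \<in> U" shows "\<sigma> p * \<sigma> p = 1"
proof -
  have "\<sigma> p * \<sigma> p = m p * m p * (\<kappa> p * \<kappa> p) / (q p * q p)"
    by (simp add: \<sigma>_def)
  also have "\<dots> = 1"
    unfolding q_sq[OF p] kappa_sq[OF p] using n_ne[OF p] m_ne[OF p] by simp
  finally show ?thesis .
qed

lemma m_sigma: assumes p: "p \<in> U" shows "m p = \<sigma> p * q p / \<kappa> p"
  using q_ne[OF p] kappa_ne[OF p] by (simp add: \<sigma>_def)

lemma n_sigma: assumes p: "p \<in> U" shows "n p = \<sigma> p * q p * \<kappa> p"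
proof -
  have "\<sigma> p * q p * \<kappa> p = m p * (\<kappa> p * \<kappa> p)"
    using q_ne[OF p] by (simp add: \<sigma>_def)
  then show ?thesis unfolding kappa_sq[OF p] using m_ne[OF p] by simp
qed

lemma A_x: assumes p: "p \<in> U" shows "D1 A p = m p - A p"
  unfolding m_eq[OF p] A_def[abs_def] momentum_def
  by (simp only: D1_cmult[OF smooth_on_diff[OF U u smooth_on_D1[OF U u]] p]
      D1_diff[OF u smooth_on_D1[OF U u] p]) (simp add: algebra_simps)

lemma B_x: assumes p: "p \<in> U" shows "D1 B p = B p - n p"
  unfolding n_eq[OF p] B_def[abs_def] momentum_def
  by (simp only: D1_cmult[OF smooth_on_add[OF U v smooth_on_D1[OF U v]] p]
      D1_add[OF v smooth_on_D1[OF U v] p]) (simp add: algebra_simps)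

text \<open>This is the rescaled system with the products expanded: u - u_x = 2A and v + v_x = -2B
  turn the coefficients -1/2 and 1/2 into 2 and -2.\<close>

lemma
  assumes p: "p \<in> U"
  shows m_t: "D2 m p = D1 m p * H p + m p * D1 H p + m p * H p + 2 * (m p * A p * B p)"
    and n_t: "D2 n p = D1 n p * H p + n p * D1 H p - n p * H p - 2 * (n p * A p * B p)"
proof -
  note mu = smooth_momentum[OF u] and mv = smooth_momentum[OF v]
  have "D2 (momentum u) p = D1 (\<lambda>r. momentum u r * H r) p + momentum u p * H p
      - 1/2 * momentum u p * (u p - D1 u p) * (v p + D1 v p)"
    and "D2 (momentum v) p = D1 (\<lambda>r. momentum v r * H r) p - momentum v p * H p
      + 1/2 * momentum v p * (u p - D1 u p) * (v p + D1 v p)"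
    using sol p by (simp_all add: is_solution_def Let_def)
  then have U_t: "D2 (momentum u) p = D1 (momentum u) p * H p + D1 H p * momentum u p + momentum u p * H p
      - 1/2 * momentum u p * (u p - D1 u p) * (v p + D1 v p)"
    and V_t: "D2 (momentum v) p = D1 (momentum v) p * H p + D1 H p * momentum v p - momentum v p * H p
      + 1/2 * momentum v p * (u p - D1 u p) * (v p + D1 v p)"
    by (simp_all only: D1_mult[OF mu smooth_H p] D1_mult[OF mv smooth_H p])
  have m1: "D1 m p = 1/2 * D1 (momentum u) p" "D2 m p = 1/2 * D2 (momentum u) p"
    using D1_cong[OF U p m_eq] D2_cong[OF U p m_eq]
    by (simp_all only: D1_cmult[OF mu p] D2_cmult[OF mu p])
  have n1: "D1 n p = - 1/2 * D1 (momentum v) p" "D2 n p = - 1/2 * D2 (momentum v) p"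
    using D1_cong[OF U p n_eq] D2_cong[OF U p n_eq]
    by (simp_all only: D1_cmult[OF mv p] D2_cmult[OF mv p])
  show "D2 m p = D1 m p * H p + m p * D1 H p + m p * H p + 2 * (m p * A p * B p)"
    unfolding m1 m_eq[OF p] U_t A_def B_def by (simp add: field_simps)
  show "D2 n p = D1 n p * H p + n p * D1 H p - n p * H p - 2 * (n p * A p * B p)"
    unfolding n1 n_eq[OF p] V_t A_def B_def by (simp add: field_simps)
qed

text \<open>Differentiate q^2 = mn in x and in t. In m_t n + n_t m the terms mH + 2mAB and -nH -
  2nAB cancel, which leaves only the terms of a conservation law.\<close>

lemma q_t: assumes p: "p \<in> U" shows "D2 q p = H p * D1 q p + q p * D1 H p"
proof -
  have x: "D1 q p * q p + D1 q p * q p = D1 m p * n p + D1 n p * m p"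
    using D1_cong[OF U p, of "\<lambda>r. q r * q r" "\<lambda>r. m r * n r"] q_sq
    by (simp only: D1_mult[OF smooth_q smooth_q p] D1_mult[OF smooth_m smooth_n p])
  have t: "D2 q p * q p + D2 q p * q p = D2 m p * n p + D2 n p * m p"
    using D2_cong[OF U p, of "\<lambda>r. q r * q r" "\<lambda>r. m r * n r"] q_sq
    by (simp only: D2_mult[OF smooth_q smooth_q p] D2_mult[OF smooth_m smooth_n p])
  have "2 * q p * D2 q p = (D1 m p * n p + D1 n p * m p) * H p + 2 * (m p * n p) * D1 H p"
    using t unfolding m_t[OF p] n_t[OF p] by (simp add: algebra_simps)
  also have "\<dots> = 2 * q p * (H p * D1 q p + q p * D1 H p)"
    unfolding x[symmetric] q_sq[OF p, symmetric] by (simp add: algebra_simps)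
  finally show ?thesis using q_ne[OF p] by simp
qed

lemma conservation_law: assumes p: "p \<in> U" shows "D2 q p = D1 (\<lambda>r. q r * H r) p"
  unfolding q_t[OF p] D1_mult[OF smooth_q smooth_H p] by simp

text \<open>Differentiate kappa^2 m = n. Now the H_x terms cancel, while the terms with H + 2AB add
  up.\<close>

lemma kappa_t: assumes p: "p \<in> U" shows "D2 \<kappa> p = H p * D1 \<kappa> p - \<kappa> p * (H p + 2 * (A p * B p))"
proof -
  have eq: "\<kappa> r * \<kappa> r * m r = n r" if "r \<in> U" for r
    using kappa_sq[OF that] m_ne[OF that] by simp
  note kk = smooth_on_mult[OF U smooth_kappa smooth_kappa]
  have x: "(D1 \<kappa> p * \<kappa> p + D1 \<kappa> p * \<kappa> p) * m p + D1 m p * (\<kappa> p * \<kappa> p) = D1 n p"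
    using D1_cong[OF U p, of "\<lambda>r. \<kappa> r * \<kappa> r * m r" n] eq
    by (simp only: D1_mult[OF kk smooth_m p] D1_mult[OF smooth_kappa smooth_kappa p])
  have t: "(D2 \<kappa> p * \<kappa> p + D2 \<kappa> p * \<kappa> p) * m p + D2 m p * (\<kappa> p * \<kappa> p) = D2 n p"
    using D2_cong[OF U p, of "\<lambda>r. \<kappa> r * \<kappa> r * m r" n] eq
    by (simp only: D2_mult[OF kk smooth_m p] D2_mult[OF smooth_kappa smooth_kappa p])
  have "2 * \<kappa> p * m p * D2 \<kappa> p = D2 n p - D2 m p * (\<kappa> p * \<kappa> p)"
    unfolding t[symmetric] by (simp add: algebra_simps)
  also have "\<dots> = 2 * \<kappa> p * m p * (H p * D1 \<kappa> p - \<kappa> p * (H p + 2 * (A p * B p)))"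
    unfolding m_t[OF p] n_t[OF p] x[symmetric] eq[OF p, symmetric] by (simp add: algebra_simps)
  finally show ?thesis using kappa_ne[OF p] m_ne[OF p] by simp
qed

text \<open>Passing from D_t to D_T = D_t - H D_x removes the transport terms H q_x and H kappa_x;
  the other equations are divided by q.\<close>

lemma transformed:
  assumes WU: "W \<subseteq> U" and rt: "reciprocal_transformation q H W X"
  shows "transformed_fields (recip_map X ` W) (pushforward W X q) (pushforward W X \<kappa>)
    (pushforward W X \<sigma>) (pushforward W X A) (pushforward W X B) (pushforward W X H)"
proof
  note sub = smooth_on_subset[OF _ WU]
  note sm = smooth_on_pushforward[OF rt sub]
  show "open (recip_map X ` W)" using rt unfolding reciprocal_transformation_def by blast
  show "smooth_on (recip_map X ` W) (pushforward W X q)" by (intro sm smooth_q)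
  show "smooth_on (recip_map X ` W) (pushforward W X \<kappa>)" by (intro sm smooth_kappa)
  show "smooth_on (recip_map X ` W) (pushforward W X \<sigma>)" by (intro sm smooth_sigma)
  show "smooth_on (recip_map X ` W) (pushforward W X A)" by (intro sm smooth_A)
  show "smooth_on (recip_map X ` W) (pushforward W X B)" by (intro sm smooth_B)
  show "smooth_on (recip_map X ` W) (pushforward W X H)" by (intro sm smooth_H)
  fix P assume P: "P \<in> recip_map X ` W"
  then have p: "inv_into W (recip_map X) P \<in> U" (is "?p \<in> U")
    using reciprocal_inverse(1) WU by blast
  note pf = pushforward_def
  note ne = q_ne[OF p] kappa_ne[OF p]
  note DX = D1_pushforward[OF rt sub P] and DT = D2_pushforward[OF rt sub P]
  show "pushforward W X q P > 0" unfolding pf by (rule q_pos[OF p])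
  show "pushforward W X \<kappa> P > 0" unfolding pf by (rule kappa_pos[OF p])
  show "pushforward W X \<sigma> P * pushforward W X \<sigma> P = 1" unfolding pf by (rule sigma_sq[OF p])
  show "D1 (pushforward W X A) P = pushforward W X \<sigma> P / pushforward W X \<kappa> P - pushforward W X A P / pushforward W X q P"
    unfolding DX[OF smooth_A] unfolding pf A_x[OF p] m_sigma[OF p] using ne by (simp add: field_simps)
  show "D1 (pushforward W X B) P = pushforward W X B P / pushforward W X q P - pushforward W X \<sigma> P * pushforward W X \<kappa> P"
    unfolding DX[OF smooth_B] unfolding pf B_x[OF p] n_sigma[OF p] using ne by (simp add: field_simps)
  show "D2 (pushforward W X q) P = pushforward W X q P * pushforward W X q P * D1 (pushforward W X H) P"
    unfolding DX[OF smooth_H] DT[OF smooth_q] unfolding pf q_t[OF p] using ne by simp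
  show "D2 (pushforward W X \<kappa>) P = - pushforward W X \<kappa> P *
      (pushforward W X H P + 2 * (pushforward W X A P * pushforward W X B P))"
    unfolding DT[OF smooth_kappa] unfolding pf kappa_t[OF p] by simp
qed

lemma triangular:
  assumes WU: "W \<subseteq> U" and rt: "reciprocal_transformation q H W X"
    and ne: "\<And>P. P \<in> recip_map X ` W \<Longrightarrow> theta_field (pushforward W X q) (pushforward W X \<kappa>) P \<noteq> 0"
  shows "triangular_system (kappa_rate h \<Omega> J) (recip_map X ` W)
    (theta_field (pushforward W X q) (pushforward W X \<kappa>)) (pushforward W X \<kappa>)"
proof -
  interpret T: transformed_fields "recip_map X ` W" "pushforward W X q" "pushforward W X \<kappa>"
    "pushforward W X \<sigma>" "pushforward W X A" "pushforward W X B" "pushforward W X H"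
    by (rule transformed[OF WU rt])
  let ?V = "recip_map X ` W" and ?\<kappa> = "pushforward W X \<kappa>" and ?q = "pushforward W X q"
  let ?\<theta> = "theta_field ?q ?\<kappa>"
  \<comment> \<open>The nonlocal variables are taken from the given solution: the sign and the
    rescaled u and v. Index 2 is v; higher indices repeat it, so that all \<open>w i\<close> are
    smooth.\<close>
  define w where "w = (\<lambda>i::nat. if i = 0 then pushforward W X \<sigma> else
    if i = 1 then pushforward W X u_resc else pushforward W X v_resc)"
  have w: "w 0 = pushforward W X \<sigma>" "w (Suc 0) = pushforward W X u_resc" "w 1 = pushforward W X u_resc" "w 2 = pushforward W X v_resc"
    by (simp_all add: w_def)
  note sub = smooth_on_subset[OF _ WU]
  have jet: "deval ?\<theta> ?\<kappa> w (jet_expr z) P = pushforward W X (jet_val u v z) P" if "P \<in> ?V" for z P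
  proof (cases z)
    case (Ujet j)
    show ?thesis unfolding Ujet jet_expr.simps jet_val.simps
      by (rule deval_dx_expr_funpow[OF rt sub[OF u] T.deval_q_expr _ that]; simp add: w u_resc_def v_resc_def pushforward_def)
  next
    case (Vjet j)
    show ?thesis unfolding Vjet jet_expr.simps jet_val.simps
      by (rule deval_dx_expr_funpow[OF rt sub[OF v] T.deval_q_expr _ that]; simp add: w u_resc_def v_resc_def pushforward_def)
  qed
  \<comment> \<open>The argument of h is recovered as the jet of (u, v) at the preimage point, which
    gives both its membership in \<open>\<Omega>\<close> and the value H.\<close>
  have jet_point: "(\<chi> i. deval ?\<theta> ?\<kappa> w (jet_expr (J i)) P) = jet_point J u v (inv_into W (recip_map X) P)"
    if "P \<in> ?V" for P
    by (simp only: jet[OF that]) (simp add: pushforward_def jet_point_def)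
  have jet_def: "defined_on ?V ?\<theta> ?\<kappa> w (jet_expr z)" for z
    by (cases z) (simp_all add: defined_dx_expr_funpow[OF T.defined_q_expr])
  have ab_defined: "defined_on ?V ?\<theta> ?\<kappa> w (a_expr :: 'k dexpr)" "defined_on ?V ?\<theta> ?\<kappa> w (b_expr :: 'k dexpr)"
    using T.defined_a_expr[OF ne] T.defined_b_expr[OF ne] by blast+
  have a_val: "deval ?\<theta> ?\<kappa> w (a_expr :: 'k dexpr) P = T.a P"
    and b_val: "deval ?\<theta> ?\<kappa> w (b_expr :: 'k dexpr) P = T.b P" if "P \<in> ?V" for P
    using T.deval_a_expr[OF ne] T.deval_b_expr[OF ne] that by blast+
  let ?e = "Add (Fn h \<Omega> (\<lambda>i. jet_expr (J i))) (Mul (Const 2) (Mul a_expr b_expr))"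
  have in_\<Omega>: "jet_point J u v (inv_into W (recip_map X) P) \<in> \<Omega>" if "P \<in> ?V" for P
    using sol reciprocal_inverse(1)[OF that] WU unfolding is_solution_def pushforward_def by blast
  have e_def: "defined_on ?V ?\<theta> ?\<kappa> w ?e"
    by (simp add: jet_def jet_point in_\<Omega> ab_defined)
  have e_val: "deval ?\<theta> ?\<kappa> w ?e P = pushforward W X H P + 2 * (T.a P * T.b P)" if "P \<in> ?V" for P
    unfolding deval.simps jet_point[OF that] a_val[OF that] b_val[OF that]
    by (simp add: pushforward_def Hfield_def)
  have w_smooth: "smooth_on ?V (w i)" for i
    unfolding w_def by (simp add: smooth_on_pushforward[OF rt] sub smooth_sigma smooth_u_resc smooth_v_resc)
  have w1: "pushforward W X u_resc P - ?q P * D1 (pushforward W X u_resc) P = pushforward W X A P"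
    and w2: "pushforward W X v_resc P + ?q P * D1 (pushforward W X v_resc) P = pushforward W X B P"
    if P: "P \<in> ?V" for P
  proof -
    have p: "inv_into W (recip_map X) P \<in> U" using reciprocal_inverse(1)[OF P] WU by blast
    show "pushforward W X u_resc P - ?q P * D1 (pushforward W X u_resc) P = pushforward W X A P"
      unfolding D1_pushforward[OF rt sub[OF smooth_u_resc] P] using T.ne(1)[OF P]
      by (simp add: pushforward_def A_def u_resc_def u_resc_x[OF p] algebra_simps)
    show "pushforward W X v_resc P + ?q P * D1 (pushforward W X v_resc) P = pushforward W X B P"
      unfolding D1_pushforward[OF rt sub[OF smooth_v_resc] P] using T.ne(1)[OF P]
      by (simp add: pushforward_def B_def v_resc_def v_resc_x[OF p] algebra_simps)
  qed
  \<comment> \<open>\<open>nonlocal_values\<close> admits every choice of integration constants, so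
    it suffices that this \<open>w\<close> satisfies the three linear equations.\<close>
  have "deval ?\<theta> ?\<kappa> w ?e \<in> nonlocal_values (kappa_rate h \<Omega> J) ?V ?\<theta> ?\<kappa>"
    unfolding nonlocal_values_def kappa_rate_def prod.case
  proof (rule CollectI, intro exI[of _ w] conjI refl e_def allI impI)
    fix i assume "i < length (nonlocal_eqs :: ('k dexpr list \<times> 'k dexpr) list)"
    then consider "i = 0" | "i = 1" | "i = 2" by (auto simp: nonlocal_eqs_def less_Suc_eq)
    then show "case (nonlocal_eqs :: ('k dexpr list \<times> 'k dexpr) list) ! i of (as, f) \<Rightarrow>
      (\<forall>a\<in>set as. defined_on ?V ?\<theta> ?\<kappa> w a) \<and> defined_on ?V ?\<theta> ?\<kappa> w f \<and>
      (\<forall>P\<in>?V. deval ?\<theta> ?\<kappa> w (last as) P \<noteq> 0 \<and>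
        (\<Sum>j<length as. deval ?\<theta> ?\<kappa> w (as ! j) P * (D1 ^^ j) (w i) P) = deval ?\<theta> ?\<kappa> w f P)"
    proof cases
      case 1
      then show ?thesis by (simp add: nonlocal_eqs_def w T.S_X)
    next
      case 2
      then show ?thesis
        using T.ne w1 T.A_eq
        by (simp add: nonlocal_eqs_def w T.defined_q_expr ab_defined T.deval_q_expr a_val)
    next
      case 3
      then show ?thesis
        using T.ne w2 T.B_eq
        by (simp add: nonlocal_eqs_def w T.defined_q_expr ab_defined T.deval_q_expr b_val)
    qed
  qed (rule w_smooth)
  moreover have "D2 ?\<kappa> P + ?\<kappa> P * deval ?\<theta> ?\<kappa> w ?e P = 0" if "P \<in> ?V" for P
    unfolding e_val[OF that] by (rule T.kappa_equation[OF that])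
  ultimately show ?thesis
    unfolding triangular_system_def
    by (intro conjI ballI T.smooth_theta T.sm(2) T.theta_equation[OF ne]) blast+
qed

end

section \<open>Existence of the transformation and the triangular system\<close>

theorem theorem1:
  fixes h :: "real ^ 'k \<Rightarrow> real" and \<Omega> :: "(real ^ 'k) set" and J :: "'k \<Rightarrow> jetvar"
  assumes "open \<Omega>" and "smooth_on \<Omega> h"
  shows "\<exists>F :: 'k nonlocal_fun. wf_nonlocal F \<and>
    (\<forall>U u v. is_solution h \<Omega> J U u v \<and> (\<forall>p\<in>U. m_resc u p * n_resc v p > 0) \<longrightarrow>
      (let q = q_field u v; H = Hfield h J u v in
        (\<forall>p\<in>U. \<exists>W X. p \<in> W \<and> W \<subseteq> U \<and> reciprocal_transformation q H W X) \<and>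
        (\<forall>W X. W \<subseteq> U \<and> reciprocal_transformation q H W X \<longrightarrow>
          (let V = recip_map X ` W;
               \<kappa> = pushforward W X (kappa_field u v);
               \<theta> = theta_field (pushforward W X q) \<kappa>
           in (\<forall>P\<in>V. \<theta> P \<noteq> 0) \<longrightarrow> triangular_system F V \<theta> \<kappa>))))"
proof (intro exI[of _ "kappa_rate h \<Omega> J"] conjI wf_kappa_rate assms allI impI)
  fix U u v
  assume "is_solution h \<Omega> J U u v \<and> (\<forall>p\<in>U. m_resc u p * n_resc v p > 0)"
  then interpret positive_solution h \<Omega> J U u v
    using assms by unfold_locales auto
  show "let q = q_field u v; H = Hfield h J u v in
        (\<forall>p\<in>U. \<exists>W X. p \<in> W \<and> W \<subseteq> U \<and> reciprocal_transformation q H W X) \<and>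
        (\<forall>W X. W \<subseteq> U \<and> reciprocal_transformation q H W X \<longrightarrow>
          (let V = recip_map X ` W;
               \<kappa> = pushforward W X (kappa_field u v);
               \<theta> = theta_field (pushforward W X q) \<kappa>
           in (\<forall>P\<in>V. \<theta> P \<noteq> 0) \<longrightarrow> triangular_system (kappa_rate h \<Omega> J) V \<theta> \<kappa>))"
    unfolding Let_def
    using reciprocal_transformation_exists[OF U _ smooth_q smooth_H q_pos conservation_law] triangular
    by blast
qed

end
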